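(* Let $L$ be an intermediate logic algebraized by a variety of Heyting algebras contained in $\mathsf{DHA}$. Then $L$ is hereditarily structurally complete and has the infinite Beth definability property.
   Context: An intermediate logic is a consistent axiomatic extension of intuitionistic propositional logic (closed under substitution and modus ponens), viewed as a consequence relation $\vdash_L$ (derivations from premises using theorems of $L$ and modus ponens); it is algebraized by the variety of Heyting algebras validating its theorems. A finitary consequence relation is structurally complete if every rule admissible in it (i.e. not enlarging its set of theorems when added) is derivable. $L$ is hereditarily structurally complete if every finitary extension of $\vdash_L$ (in the same language, closed under substitutions) is structurally complete. $L$ has the infinite Beth definability property if for all disjoint sets of variables $X,Y$ and every set of formulas $\Gamma(X,Y)$: whenever $\Gamma(X,Y)\cup\Gamma(X,Y')\vdash_L y\leftrightarrow y'$ for every $y\in Y$ (with $Y'$ a disjoint copy of $Y$ and $y'$ the copy of $y$), then for each $y\in Y$ there is a formula $\varphi_y(X)$ with $\Gamma(X,Y)\vdash_L y\leftrightarrow\varphi_y$. For a poset $X$, $\mathrm{Up}(X)$ is the Heyting algebra of upsets. A poset satisfies the three point rule if for all distinct $x,y,z$, if $x,y$ are incomparable and $x\le z$ then $y\le z$. A poset $X$ is a diamond system if: (D1) each ${\uparrow}x=\{y:x\le y\}$ satisfies the three point rule; (D2) no ${\uparrow}x$ contains a $3$-element antichain; (D3) for all $x$ and $y,z\in{\uparrow}x$ there is $w$ with $y,z\le w$; (D4) whenever $\bot\le x,y$, $x,y\le z,v$, $z,v\le\top$, there is $w$ with $x,y\le w\le z,v$. A diamond sequence is a diamond system in which any two elements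 have a common lower bound. $\mathsf{DHA}$ is the variety generated by $\{\mathrm{Up}(X): X$ a finite diamond sequence$\}$. *)

theory Defs
  imports "HOL-Algebra.Lattice"
begin

section \<open>Formulas and intermediate logics\<close>

datatype (vars: 'v) fm =
    Var 'v
  | Bot
  | Top
  | And "'v fm" "'v fm"
  | Or "'v fm" "'v fm"
  | Imp "'v fm" "'v fm"
  for map: rename

abbreviation Iff :: "'v fm \<Rightarrow> 'v fm \<Rightarrow> 'v fm" where
  "Iff p q \<equiv> And (Imp p q) (Imp q p)"

primrec subst :: "('u \<Rightarrow> 'v fm) \<Rightarrow> 'u fm \<Rightarrow> 'v fm" where
  "subst s (Var x) = s x"
| "subst s Bot = Bot"
| "subst s Top = Top"
| "subst s (And p q) = And (subst s p) (subst s q)"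
| "subst s (Or p q) = Or (subst s p) (subst s q)"
| "subst s (Imp p q) = Imp (subst s p) (subst s q)"

inductive_set IPC :: "'v fm set" where
  K: "Imp p (Imp q p) \<in> IPC"
| S: "Imp (Imp p (Imp q r)) (Imp (Imp p q) (Imp p r)) \<in> IPC"
| and_left: "Imp (And p q) p \<in> IPC"
| and_right: "Imp (And p q) q \<in> IPC"
| and_intro: "Imp p (Imp q (And p q)) \<in> IPC"
| or_left: "Imp p (Or p q) \<in> IPC"
| or_right: "Imp q (Or p q) \<in> IPC"
| or_elim: "Imp (Imp p r) (Imp (Imp q r) (Imp (Or p q) r)) \<in> IPC"
| bot_elim: "Imp Bot p \<in> IPC"
| top_intro: "Top \<in> IPC"
| mp: "Imp p q \<in> IPC \<Longrightarrow> p \<in> IPC \<Longrightarrow> q \<in> IPC"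

definition intermediate_logic :: "nat fm set \<Rightarrow> bool" where
  "intermediate_logic L \<longleftrightarrow>
     IPC \<subseteq> L \<and>
     (\<forall>s. \<forall>p\<in>L. subst s p \<in> L) \<and>
     (\<forall>p q. Imp p q \<in> L \<longrightarrow> p \<in> L \<longrightarrow> q \<in> L) \<and>
     L \<noteq> UNIV"

text \<open>
  A logic is given by its theorems in countably many variables.  Its consequence relation is
  needed over variable sets of any cardinality; there its theorems are the substitution
  instances of the elements of \<open>L\<close>.
\<close>

inductive entails :: "nat fm set \<Rightarrow> 'v fm set \<Rightarrow> 'v fm \<Rightarrow> bool"
  for L :: "nat fm set" and G :: "'v fm set" where
  premise: "p \<in> G \<Longrightarrow> entails L G p"
| thm_instance: "p \<in> L \<Longrightarrow> entails L G (subst s p)"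
| mp: "entails L G (Imp p q) \<Longrightarrow> entails L G p \<Longrightarrow> entails L G q"


section \<open>Structural completeness\<close>

text \<open>Monotonicity in the premises follows from reflexivity and cut.\<close>

definition consequence_relation :: "('v fm set \<Rightarrow> 'v fm \<Rightarrow> bool) \<Rightarrow> bool" where
  "consequence_relation C \<longleftrightarrow>
     (\<forall>G. \<forall>p\<in>G. C G p) \<and>
     (\<forall>G D p. (\<forall>q\<in>D. C G q) \<longrightarrow> C D p \<longrightarrow> C G p) \<and>
     (\<forall>s G p. C G p \<longrightarrow> C (subst s ` G) (subst s p))"

definition finitary :: "('v fm set \<Rightarrow> 'v fm \<Rightarrow> bool) \<Rightarrow> bool" where
  "finitary C \<longleftrightarrow> (\<forall>G p. C G p \<longrightarrow> (\<exists>D\<subseteq>G. finite D \<and> C D p))"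

definition add_rule ::
  "('v fm set \<Rightarrow> 'v fm \<Rightarrow> bool) \<Rightarrow> 'v fm set \<Rightarrow> 'v fm \<Rightarrow> 'v fm set \<Rightarrow> 'v fm \<Rightarrow> bool" where
  "add_rule C G p = (\<lambda>D q. \<forall>C'. consequence_relation C' \<and> C \<le> C' \<and> C' G p \<longrightarrow> C' D q)"

definition admissible :: "('v fm set \<Rightarrow> 'v fm \<Rightarrow> bool) \<Rightarrow> 'v fm set \<Rightarrow> 'v fm \<Rightarrow> bool" where
  "admissible C G p \<longleftrightarrow> {q. add_rule C G p {} q} = {q. C {} q}"

definition structurally_complete :: "('v fm set \<Rightarrow> 'v fm \<Rightarrow> bool) \<Rightarrow> bool" where
  "structurally_complete C \<longleftrightarrow> (\<forall>G p. finite G \<longrightarrow> admissible C G p \<longrightarrow> C G p)"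

definition hereditarily_structurally_complete :: "nat fm set \<Rightarrow> bool" where
  "hereditarily_structurally_complete L \<longleftrightarrow>
     (\<forall>C :: nat fm set \<Rightarrow> nat fm \<Rightarrow> bool.
        consequence_relation C \<longrightarrow> finitary C \<longrightarrow> entails L \<le> C \<longrightarrow> structurally_complete C)"


section \<open>The infinite Beth property\<close>

text \<open>
  The variables \<open>X \<union> Y\<close> are taken from \<open>'v\<close>, and the disjoint copy of \<open>Y\<close> is \<open>Inr ` Y\<close> in
  \<open>'v + 'v\<close>, so that a copy exists whatever the size of \<open>Y\<close>.  The property in full is the
  property below for all types \<open>'v\<close>.
\<close>

definition infinite_beth_property :: "'v itself \<Rightarrow> nat fm set \<Rightarrow> bool" where
  "infinite_beth_property (T :: 'v itself) L \<longleftrightarrow>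
     (\<forall>(X :: 'v set) Y G.
        X \<inter> Y = {} \<longrightarrow> (\<forall>p\<in>G. vars p \<subseteq> X \<union> Y) \<longrightarrow>
        (\<forall>y\<in>Y. entails L
                 (rename Inl ` G \<union> rename (\<lambda>v. if v \<in> Y then Inr v else Inl v) ` G)
                 (Iff (Var (Inl y :: 'v + 'v)) (Var (Inr y)))) \<longrightarrow>
        (\<forall>y\<in>Y. \<exists>p. vars p \<subseteq> X \<and> entails L G (Iff (Var y) p)))"


section \<open>Heyting algebras and varieties\<close>

locale heyting_algebra = bounded_lattice L for L (structure) +
  assumes relative_pseudocomplement_exists:
    "\<lbrakk>a \<in> carrier L; b \<in> carrier L\<rbrakk> \<Longrightarrow> \<exists>c. greatest L c {x \<in> carrier L. x \<sqinter> a \<sqsubseteq> b}"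

definition himp :: "('a, 'b) gorder_scheme \<Rightarrow> 'a \<Rightarrow> 'a \<Rightarrow> 'a" where
  "himp A a b = (THE c. greatest A c {x \<in> carrier A. x \<sqinter>\<^bsub>A\<^esub> a \<sqsubseteq>\<^bsub>A\<^esub> b})"

text \<open>Formulas double as terms in the language of Heyting algebras.\<close>

primrec eval :: "('a, 'b) gorder_scheme \<Rightarrow> ('v \<Rightarrow> 'a) \<Rightarrow> 'v fm \<Rightarrow> 'a" where
  "eval A h (Var x) = h x"
| "eval A h Bot = \<bottom>\<^bsub>A\<^esub>"
| "eval A h Top = \<top>\<^bsub>A\<^esub>"
| "eval A h (And p q) = eval A h p \<sqinter>\<^bsub>A\<^esub> eval A h q"
| "eval A h (Or p q) = eval A h p \<squnion>\<^bsub>A\<^esub> eval A h q"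
| "eval A h (Imp p q) = himp A (eval A h p) (eval A h q)"

definition satisfies_eq :: "'a gorder \<Rightarrow> 'v fm \<times> 'v fm \<Rightarrow> bool" where
  "satisfies_eq A e \<longleftrightarrow>
     (\<forall>h. range h \<subseteq> carrier A \<longrightarrow> eval A h (fst e) = eval A h (snd e))"

text \<open>
  Varieties are equational classes, and the variety generated by a class is the least one
  containing it.  As a class of algebras lives on a single type, the equations are what
  identifies a variety across types; \<open>'b\<close> hosts the generators and \<open>'a\<close> the members.
  A variety is determined by its countably generated free algebras, whose elements are classes
  of equivalent formulas, so an inclusion of varieties can be tested on the type \<open>nat fm set\<close>.
\<close>

definition variety_of_equations :: "(nat fm \<times> nat fm) set \<Rightarrow> 'a gorder set" where
  "variety_of_equations E = {A. heyting_algebra A \<and> (\<forall>e\<in>E. satisfies_eq A e)}"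

definition generated_variety :: "'b gorder set \<Rightarrow> 'a gorder set" where
  "generated_variety K = \<Inter> {variety_of_equations E | E. K \<subseteq> variety_of_equations E}"

definition variety_of_logic :: "nat fm set \<Rightarrow> 'a gorder set" where
  "variety_of_logic L = variety_of_equations {(p, Top) | p. p \<in> L}"


section \<open>Diamond systems\<close>

definition Up :: "'a gorder \<Rightarrow> 'a set gorder" where
  "Up X = \<lparr>carrier = {U. U \<subseteq> carrier X \<and> (\<forall>x\<in>U. \<forall>y\<in>carrier X. x \<sqsubseteq>\<^bsub>X\<^esub> y \<longrightarrow> y \<in> U)},
           eq = (=), le = (\<subseteq>)\<rparr>"

definition principal_upset :: "'a gorder \<Rightarrow> 'a \<Rightarrow> 'a gorder" where
  "principal_upset X x = X\<lparr>carrier := {y \<in> carrier X. x \<sqsubseteq>\<^bsub>X\<^esub> y}\<rparr>"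

definition three_point_rule :: "'a gorder \<Rightarrow> bool" where
  "three_point_rule X \<longleftrightarrow>
     (\<forall>x\<in>carrier X. \<forall>y\<in>carrier X. \<forall>z\<in>carrier X.
        x \<noteq> y \<longrightarrow> y \<noteq> z \<longrightarrow> x \<noteq> z \<longrightarrow>
        \<not> x \<sqsubseteq>\<^bsub>X\<^esub> y \<longrightarrow> \<not> y \<sqsubseteq>\<^bsub>X\<^esub> x \<longrightarrow> x \<sqsubseteq>\<^bsub>X\<^esub> z \<longrightarrow> y \<sqsubseteq>\<^bsub>X\<^esub> z)"

definition antichain :: "'a gorder \<Rightarrow> 'a set \<Rightarrow> bool" where
  "antichain X A \<longleftrightarrow> A \<subseteq> carrier X \<and> (\<forall>a\<in>A. \<forall>b\<in>A. a \<sqsubseteq>\<^bsub>X\<^esub> b \<longrightarrow> a = b)"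

locale diamond_system = partial_order X for X :: "'a gorder" (structure) +
  assumes D1: "x \<in> carrier X \<Longrightarrow> three_point_rule (principal_upset X x)"
    and D2: "x \<in> carrier X \<Longrightarrow> \<not> (\<exists>A. antichain (principal_upset X x) A \<and> card A = 3)"
    and D3: "\<lbrakk>x \<in> carrier X; y \<in> carrier X; z \<in> carrier X; x \<sqsubseteq> y; x \<sqsubseteq> z\<rbrakk>
      \<Longrightarrow> \<exists>w\<in>carrier X. y \<sqsubseteq> w \<and> z \<sqsubseteq> w"
    and D4: "\<lbrakk>b \<in> carrier X; x \<in> carrier X; y \<in> carrier X; z \<in> carrier X; v \<in> carrier X;
        t \<in> carrier X; b \<sqsubseteq> x; b \<sqsubseteq> y; x \<sqsubseteq> z; x \<sqsubseteq> v; y \<sqsubseteq> z; y \<sqsubseteq> v; z \<sqsubseteq> t; v \<sqsubseteq> t\<rbrakk>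
      \<Longrightarrow> \<exists>w\<in>carrier X. x \<sqsubseteq> w \<and> y \<sqsubseteq> w \<and> w \<sqsubseteq> z \<and> w \<sqsubseteq> v"

locale diamond_sequence = diamond_system +
  assumes common_lower_bound:
    "\<lbrakk>x \<in> carrier X; y \<in> carrier X\<rbrakk> \<Longrightarrow> \<exists>w\<in>carrier X. w \<sqsubseteq> x \<and> w \<sqsubseteq> y"

text \<open>Every finite poset has an isomorphic copy on a set of natural numbers.\<close>

definition DHA :: "'a gorder set" where
  "DHA = generated_variety
     {Up X | X :: nat gorder. finite (carrier X) \<and> diamond_sequence X}"

end

theory Submission
  imports Defs
begin

text \<open>
  Only two consequences of the inclusion in \<open>DHA\<close> matter: modulo a prime theory, every formula
  is incomparable with at most one other, and no meet of an incomparable pair is equivalent to a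
  join of an incomparable pair.  Prime quotients of Lindenbaum algebras are thus chains of nodes in
  which some consecutive nodes are joined by a four-element diamond, and no two diamonds touch.

  For structural completeness, let \<open>F\<close> be the set of theorems of an extension of the logic and
  \<open>P\<close> a prime theory containing \<open>F\<close>.  The formulas in finitely many variables form a finite algebra
  modulo \<open>P\<close>, and climbing along its nodes one finds a section of its projection that is a
  homomorphism modulo \<open>F\<close>.  The section is a substitution that turns the elements of \<open>P\<close>, and no
  other formulas, into elements of \<open>F\<close>, so underivable rules are not admissible.

  For the Beth property, suppose that a formula is not equivalent, modulo a prime theory
  \<open>P\<close> containing the implicit definition, to a formula without the defined variables.  Then
  swapping or collapsing at most two elements gives a homomorphism from the quotient by \<open>P\<close> to
  the quotient by some \<open>F \<supseteq> P\<close> that differs from the projection and agrees with it on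
  the other variables, against implicit definability.  Hence the other variables determine the
  prime theories above the implicit definition.
\<close>

section \<open>Theories of intuitionistic logic\<close>

definition thy :: "'v fm set \<Rightarrow> bool" where
  "thy T \<longleftrightarrow> IPC \<subseteq> T \<and> (\<forall>p q. Imp p q \<in> T \<longrightarrow> p \<in> T \<longrightarrow> q \<in> T)"

definition leq :: "'v fm set \<Rightarrow> 'v fm \<Rightarrow> 'v fm \<Rightarrow> bool" where
  "leq T p q \<longleftrightarrow> Imp p q \<in> T"

definition equ :: "'v fm set \<Rightarrow> 'v fm \<Rightarrow> 'v fm \<Rightarrow> bool" where
  "equ T p q \<longleftrightarrow> leq T p q \<and> leq T q p"

definition incomp :: "'v fm set \<Rightarrow> 'v fm \<Rightarrow> 'v fm \<Rightarrow> bool" where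
  "incomp T p q \<longleftrightarrow> \<not> leq T p q \<and> \<not> leq T q p"

definition prime_thy :: "'v fm set \<Rightarrow> bool" where
  "prime_thy T \<longleftrightarrow> thy T \<and> Bot \<notin> T \<and> (\<forall>p q. Or p q \<in> T \<longrightarrow> p \<in> T \<or> q \<in> T)"

lemma thy_IPC: "thy T \<Longrightarrow> p \<in> IPC \<Longrightarrow> p \<in> T"
  by (auto simp: thy_def)

lemma thy_mp: "thy T \<Longrightarrow> Imp p q \<in> T \<Longrightarrow> p \<in> T \<Longrightarrow> q \<in> T"
  by (auto simp: thy_def)

lemma leq_mp: "thy T \<Longrightarrow> leq T p q \<Longrightarrow> p \<in> T \<Longrightarrow> q \<in> T"
  by (auto simp: leq_def intro: thy_mp)

lemma leq_of_mem: "thy T \<Longrightarrow> q \<in> T \<Longrightarrow> leq T p q"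
  unfolding leq_def by (meson IPC.K thy_IPC thy_mp)

lemma leq_S: "thy T \<Longrightarrow> leq T p (Imp q r) \<Longrightarrow> leq T p q \<Longrightarrow> leq T p r"
  unfolding leq_def by (meson IPC.S thy_IPC thy_mp)

lemma leq_refl [simp]: "thy T \<Longrightarrow> leq T p p"
  unfolding leq_def by (meson IPC.K IPC.S thy_IPC thy_mp)

lemma leq_trans: "thy T \<Longrightarrow> leq T p q \<Longrightarrow> leq T q r \<Longrightarrow> leq T p r"
  using leq_S leq_of_mem leq_def by metis

lemma leq_And_left: "thy T \<Longrightarrow> leq T (And p q) p"
  and leq_And_right: "thy T \<Longrightarrow> leq T (And p q) q"
  and leq_Or_left: "thy T \<Longrightarrow> leq T p (Or p q)"
  and leq_Or_right: "thy T \<Longrightarrow> leq T q (Or p q)"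
  and Bot_leq [simp]: "thy T \<Longrightarrow> leq T Bot p"
  and Top_mem [simp]: "thy T \<Longrightarrow> Top \<in> T"
  by (auto simp: leq_def intro: thy_IPC IPC.intros)

lemma leq_Top [simp]: "thy T \<Longrightarrow> leq T p Top"
  by (simp add: leq_of_mem)

lemma leq_And_iff: "thy T \<Longrightarrow> leq T r (And p q) \<longleftrightarrow> leq T r p \<and> leq T r q"
proof
  assume T: "thy T" and "leq T r p \<and> leq T r q"
  moreover have "leq T p (Imp q (And p q))"
    using T by (simp add: leq_def thy_IPC IPC.and_intro)
  ultimately show "leq T r (And p q)"
    by (meson leq_S leq_trans)
qed (meson leq_And_left leq_And_right leq_trans)

lemma leq_Or_iff: "thy T \<Longrightarrow> leq T (Or p q) r \<longleftrightarrow> leq T p r \<and> leq T q r"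
proof
  assume T: "thy T" and "leq T p r \<and> leq T q r"
  moreover have "Imp (Imp p r) (Imp (Imp q r) (Imp (Or p q) r)) \<in> T"
    using T by (simp add: thy_IPC IPC.or_elim)
  ultimately show "leq T (Or p q) r"
    unfolding leq_def by (meson thy_mp)
qed (meson leq_Or_left leq_Or_right leq_trans)

lemma leq_Imp_iff: "thy T \<Longrightarrow> leq T r (Imp p q) \<longleftrightarrow> leq T (And r p) q"
proof
  assume T: "thy T"
  {
    assume "leq T r (Imp p q)"
    then show "leq T (And r p) q"
      using T by (meson leq_And_left leq_And_right leq_S leq_trans)
  next
    assume "leq T (And r p) q"
    then have "leq T r (Imp p (Imp (And r p) q))"
      using T by (meson IPC.K leq_def leq_of_mem thy_IPC)
    moreover have "leq T r (Imp p (And r p))"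
      using T by (simp add: leq_def thy_IPC IPC.and_intro)
    moreover have "leq T (Imp p (Imp (And r p) q)) (Imp (Imp p (And r p)) (Imp p q))"
      using T by (simp add: leq_def thy_IPC IPC.S)
    ultimately show "leq T r (Imp p q)"
      using T by (meson leq_S leq_trans)
  }
qed

lemma mem_iff_leq: "thy T \<Longrightarrow> p \<in> T \<longleftrightarrow> leq T Top p"
  by (meson Top_mem leq_mp leq_of_mem)

lemma And_mem_iff: "thy T \<Longrightarrow> And p q \<in> T \<longleftrightarrow> p \<in> T \<and> q \<in> T"
  by (simp add: mem_iff_leq leq_And_iff)

lemma Iff_mem_iff: "thy T \<Longrightarrow> Iff p q \<in> T \<longleftrightarrow> equ T p q"
  by (simp add: And_mem_iff equ_def leq_def)

lemma mp_leq: "thy T \<Longrightarrow> leq T (And (Imp p q) p) q"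
  using leq_Imp_iff leq_refl by blast

lemma leq_Imp: "thy T \<Longrightarrow> leq T q (Imp p q)"
  by (simp add: leq_Imp_iff leq_And_left)

lemma equ_refl [simp]: "thy T \<Longrightarrow> equ T p p"
  by (simp add: equ_def)

lemma equ_sym: "equ T p q \<Longrightarrow> equ T q p"
  by (simp add: equ_def)

lemma equ_trans: "thy T \<Longrightarrow> equ T p q \<Longrightarrow> equ T q r \<Longrightarrow> equ T p r"
  unfolding equ_def by (meson leq_trans)

lemma And_mono: "thy T \<Longrightarrow> leq T p p' \<Longrightarrow> leq T q q' \<Longrightarrow> leq T (And p q) (And p' q')"
  by (meson leq_And_iff leq_And_left leq_And_right leq_trans)

lemma Or_mono: "thy T \<Longrightarrow> leq T p p' \<Longrightarrow> leq T q q' \<Longrightarrow> leq T (Or p q) (Or p' q')"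
  by (meson leq_Or_iff leq_Or_left leq_Or_right leq_trans)

lemma Imp_mono: "thy T \<Longrightarrow> leq T p' p \<Longrightarrow> leq T q q' \<Longrightarrow> leq T (Imp p q) (Imp p' q')"
  by (meson And_mono leq_Imp_iff leq_refl leq_trans mp_leq)

lemma equ_And: "thy T \<Longrightarrow> equ T p p' \<Longrightarrow> equ T q q' \<Longrightarrow> equ T (And p q) (And p' q')"
  and equ_Or: "thy T \<Longrightarrow> equ T p p' \<Longrightarrow> equ T q q' \<Longrightarrow> equ T (Or p q) (Or p' q')"
  and equ_Imp: "thy T \<Longrightarrow> equ T p p' \<Longrightarrow> equ T q q' \<Longrightarrow> equ T (Imp p q) (Imp p' q')"
  by (simp_all add: equ_def And_mono Or_mono Imp_mono)

lemma leq_mono: "leq T p q \<Longrightarrow> T \<subseteq> F \<Longrightarrow> leq F p q"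
  by (auto simp: leq_def)

text \<open>By the deduction theorem this is the theory generated by \<open>T\<close> and
  \<open>p\<close>.\<close>

lemma thy_add: "thy T \<Longrightarrow> thy {q. leq T p q}"
  unfolding thy_def[of "{q. leq T p q}"] using leq_S leq_of_mem thy_IPC by blast

lemma incomp_sym: "incomp T p q \<Longrightarrow> incomp T q p"
  by (simp add: incomp_def)

lemma prime_thyD:
  assumes "prime_thy P"
  shows "thy P" "Bot \<notin> P" "Or p q \<in> P \<Longrightarrow> p \<in> P \<or> q \<in> P"
  using assms by (auto simp: prime_thy_def)

text \<open>Zorn's lemma yields a maximal theory over \<open>T\<close> disjoint from
  \<open>I\<close>. It is prime: two formulas outside it lie below members of \<open>I\<close>, so
  their disjunction would bring the disjunction of these members into the theory. \<open>I\<close>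
  is not assumed downward closed, so that it may consist of formulas in restricted
  variables.\<close>

lemma prime_extension:
  assumes T: "thy T" and I: "\<And>p q. p \<in> I \<Longrightarrow> q \<in> I \<Longrightarrow> Or p q \<in> I" "I \<noteq> {}"
    and disj: "T \<inter> I = {}"
  obtains P where "prime_thy P" "T \<subseteq> P" "P \<inter> I = {}"
proof -
  let ?A = "{S. thy S \<and> T \<subseteq> S \<and> S \<inter> I = {}}"
  have union: "\<Union> C \<in> ?A" if C: "C \<noteq> {}" "subset.chain ?A C" for C
  proof -
    have sub: "C \<subseteq> ?A" and linear: "\<And>S S'. S \<in> C \<Longrightarrow> S' \<in> C \<Longrightarrow> S \<subseteq> S' \<or> S' \<subseteq> S"
      using C(2) unfolding subset_chain_def by blast+
    have "q \<in> \<Union> C" if pq: "Imp p q \<in> \<Union> C" "p \<in> \<Union> C" for p q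
    proof -
      obtain S1 S2 where S: "Imp p q \<in> S1" "p \<in> S2" "S1 \<in> C" "S2 \<in> C"
        using pq by blast
      then obtain S0 where S0: "S0 \<in> C" "Imp p q \<in> S0" "p \<in> S0"
        using linear[OF S(3,4)] by blast
      moreover have "thy S0"
        using sub S0(1) by blast
      ultimately show ?thesis
        using thy_mp by blast
    qed
    moreover have "IPC \<subseteq> \<Union> C" "T \<subseteq> \<Union> C" "\<Union> C \<inter> I = {}"
      using C(1) sub unfolding thy_def by blast+
    ultimately show ?thesis
      by (simp add: thy_def)
  qed
  have "?A \<noteq> {}"
    using T disj by blast
  from subset_Zorn_nonempty[OF this union]
  obtain P where P: "P \<in> ?A" and max: "\<forall>S\<in>?A. P \<subseteq> S \<longrightarrow> S = P"
    by blast
  have thyP: "thy P" and TP: "T \<subseteq> P" and PI: "P \<inter> I = {}"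
    using P by auto
  \<comment> \<open>Otherwise the theory generated by \<open>P\<close> and \<open>p\<close> would
    avoid \<open>I\<close>, against maximality.\<close>
  have ext: "\<exists>i\<in>I. leq P p i" if "p \<notin> P" for p
  proof (rule ccontr)
    assume neg: "\<not> ?thesis"
    have "P \<subseteq> {q. leq P p q}"
      using leq_of_mem[OF thyP] by blast
    moreover have "{q. leq P p q} \<in> ?A"
      using thy_add[OF thyP] neg TP calculation by auto
    ultimately have "{q. leq P p q} = P"
      using max by simp
    moreover have "p \<in> {q. leq P p q}"
      by (simp add: thyP)
    ultimately have "p \<in> P"
      by simp
    with that show False by simp
  qed
  have "p \<in> P \<or> q \<in> P" if "Or p q \<in> P" for p q
  proof (rule ccontr)
    assume "\<not> ?thesis"
    then obtain i j where "i \<in> I" "j \<in> I" "leq P p i" "leq P q j"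
      using ext by meson
    then have "Or i j \<in> P"
      using leq_mp[OF thyP Or_mono[OF thyP]] that by simp
    moreover have "Or i j \<in> I"
      by (rule I(1)) fact+
    ultimately show False
      using PI by blast
  qed
  moreover have "Bot \<notin> P"
  proof
    assume "Bot \<in> P"
    then have "\<And>p. p \<in> P"
      using leq_mp[OF thyP Bot_leq[OF thyP]] by blast
    then show False
      using I(2) PI by blast
  qed
  ultimately show ?thesis
    using that[of P] thyP TP PI by (auto simp: prime_thy_def)
qed


section \<open>Unique incomparability and separated diamonds\<close>

text \<open>
  A disjunction lies in a prime theory if and only if some disjunct does, so positive universal
  statements about the prime quotients become formulas.  In \<open>separated_fm\<close> the pair \<open>a\<close>, \<open>b\<close> is
  raised above \<open>w\<close>: incomparability of \<open>a'\<close>, \<open>b'\<close> then makes \<open>a' \<and> b'\<close> a node, and \<open>(n \<rightarrow> w) \<rightarrow> w\<close>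
  expresses \<open>n \<noteq> w\<close> for a node \<open>n\<close> above \<open>w\<close> other than the top.
\<close>

definition unique_incomp_fm :: "'v fm \<Rightarrow> 'v fm \<Rightarrow> 'v fm \<Rightarrow> 'v fm" where
  "unique_incomp_fm p q r =
     Or (Imp p q) (Or (Imp q p) (Or (Imp p r) (Or (Imp r p) (Iff q r))))"

definition separated_fm :: "'v fm \<Rightarrow> 'v fm \<Rightarrow> 'v fm \<Rightarrow> 'v fm \<Rightarrow> 'v fm" where
  "separated_fm a b c d =
     (let w = Or c d; a' = Or a w; b' = Or b w in
      Or (Imp a' b') (Or (Imp b' a') (Or (Imp c d) (Or (Imp d c)
        (Imp (Imp (And a' b') w) w)))))"

definition diamond_thy :: "'v fm set \<Rightarrow> bool" where
  "diamond_thy T \<longleftrightarrow> thy T \<and> (\<forall>p q r. unique_incomp_fm p q r \<in> T) \<and>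
     (\<forall>a b c d. separated_fm a b c d \<in> T)"

locale prime_diamond =
  fixes P :: "'v fm set"
  assumes prime: "prime_thy P" and diamond: "diamond_thy P"
begin

lemma thy: "thy P"
  using prime by (simp add: prime_thy_def)

lemmas trans = leq_trans[OF thy]

lemma refl: "leq P p p"
  by (simp add: thy)

lemma unique_incomp: "incomp P p q \<Longrightarrow> incomp P p r \<Longrightarrow> equ P q r"
proof -
  assume "incomp P p q" "incomp P p r"
  moreover have "Or (Imp p q) (Or (Imp q p) (Or (Imp p r) (Or (Imp r p) (Iff q r)))) \<in> P"
    using diamond by (simp add: diamond_thy_def unique_incomp_fm_def)
  ultimately have "Iff q r \<in> P"
    by (auto simp: leq_def incomp_def dest!: prime_thyD(3)[OF prime])
  then show "equ P q r"
    by (simp add: Iff_mem_iff thy)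
qed

lemma Top_not_leq: "leq P Top p \<longleftrightarrow> p \<in> P"
  using mem_iff_leq thy by blast

text \<open>If \<open>w\<close> were equivalent to the meet of \<open>a\<close> and
  \<open>b\<close>, raising them above \<open>w\<close> would change nothing. The last disjunct of
  \<open>separated_fm\<close> would then hold with its antecedent in \<open>P\<close>, so
  \<open>w\<close> and hence \<open>a\<close> would lie in \<open>P\<close>; but members of
  \<open>P\<close> are comparable with everything.\<close>

lemma separated:
  assumes ab: "incomp P a b" and cd: "incomp P c d"
  shows "\<not> equ P (And a b) (Or c d)"
proof
  define w where "w = Or c d"
  define a' where "a' = Or a w"
  define b' where "b' = Or b w"
  assume *: "equ P (And a b) (Or c d)"
  then have w: "leq P w (And a b)" "leq P (And a b) w"
    by (auto simp: equ_def w_def)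
  have a': "leq P a' a" "leq P a a'"
    using trans[OF w(1) leq_And_left[OF thy]] by (simp_all add: a'_def thy leq_Or_iff leq_Or_left)
  have b': "leq P b' b" "leq P b b'"
    using trans[OF w(1) leq_And_right[OF thy]] by (simp_all add: b'_def thy leq_Or_iff leq_Or_left)
  have "\<not> leq P a' b'" "\<not> leq P b' a'"
    using ab trans[OF a'(2) trans[OF _ b'(1)]] trans[OF b'(2) trans[OF _ a'(1)]]
    by (auto simp: incomp_def)
  moreover have "Or (Imp a' b') (Or (Imp b' a') (Or (Imp c d) (Or (Imp d c)
      (Imp (Imp (And a' b') w) w)))) \<in> P"
    using diamond by (simp add: diamond_thy_def separated_fm_def Let_def w_def a'_def b'_def)
  ultimately have "leq P (Imp (And a' b') w) w"
    using cd by (auto simp: leq_def incomp_def dest!: prime_thyD(3)[OF prime])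
  moreover have "leq P (And a' b') w"
    by (rule trans[OF And_mono[OF thy a'(1) b'(1)] w(2)])
  ultimately have "w \<in> P"
    using leq_mp[OF thy] by (simp add: leq_def)
  then have "a \<in> P"
    using leq_mp[OF thy w(1)] And_mem_iff[OF thy] by simp
  then show False
    using ab thy by (simp add: incomp_def leq_of_mem)
qed

section \<open>Nodes and implications in a prime quotient\<close>

definition node :: "'v fm \<Rightarrow> bool" where
  "node n \<longleftrightarrow> (\<forall>d. leq P d n \<or> leq P n d)"

lemma incomp_comparable:
  assumes "incomp P a b" "\<not> equ P b d"
  shows "leq P d a \<or> leq P a d"
  using assms unique_incomp[of a b d] unfolding incomp_def by blast

text \<open>A formula above neither \<open>a\<close> nor \<open>b\<close> is equivalent to neither,
  hence comparable with both by unique incomparability, hence below both.\<close>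

lemma node_And:
  assumes "incomp P a b"
  shows "node (And a b)"
  unfolding node_def
proof
  fix d
  show "leq P d (And a b) \<or> leq P (And a b) d"
  proof (cases "leq P a d \<or> leq P b d")
    case True
    then show ?thesis
      using leq_And_left[OF thy] leq_And_right[OF thy] trans by blast
  next
    case False
    then have "leq P d a \<and> leq P d b"
      using incomp_comparable[of a b d] incomp_comparable[of b a d] assms refl
      unfolding incomp_def equ_def by blast
    then show ?thesis
      by (simp add: leq_And_iff[OF thy])
  qed
qed

lemma node_Or:
  assumes "incomp P a b"
  shows "node (Or a b)"
  unfolding node_def
proof
  fix d
  show "leq P d (Or a b) \<or> leq P (Or a b) d"
  proof (cases "leq P d a \<or> leq P d b")
    case True
    then show ?thesis
      using leq_Or_left[OF thy] leq_Or_right[OF thy] trans by blast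
  next
    case False
    then have "leq P a d \<and> leq P b d"
      using incomp_comparable[of a b d] incomp_comparable[of b a d] assms refl
      unfolding incomp_def equ_def by blast
    then show ?thesis
      by (simp add: leq_Or_iff[OF thy])
  qed
qed

lemma node_not_equ: "node n \<Longrightarrow> incomp P d e \<Longrightarrow> \<not> equ P n d"
  unfolding node_def incomp_def equ_def using trans by blast

text \<open>\<open>d\<close> is never below \<open>Imp d e\<close>, since this would put
  \<open>d\<close> below \<open>e\<close>. If the two are comparable, \<open>Imp d e\<close> is thus
  below \<open>d\<close>, and then below \<open>e\<close> by modus ponens.\<close>

lemma Imp_cases:
  assumes "leq P e d" "\<not> leq P d e"
  shows "equ P (Imp d e) e \<or> incomp P d (Imp d e) \<and> equ P (And d (Imp d e)) e"
proof -
  have 1: "leq P e (Imp d e)"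
    by (simp add: thy leq_Imp)
  have "leq P (And d (Imp d e)) e"
    using leq_S[OF thy] leq_And_left[OF thy] leq_And_right[OF thy] by blast
  then have 2: "equ P (And d (Imp d e)) e"
    using assms(1) 1 by (simp add: equ_def thy leq_And_iff)
  show ?thesis
  proof (cases "incomp P d (Imp d e)")
    case False
    moreover have "\<not> leq P d (Imp d e)"
      using assms(2) leq_S[OF thy _ refl] by blast
    ultimately have "leq P (Imp d e) (And d (Imp d e))"
      by (simp add: incomp_def leq_And_iff thy)
    then have "equ P (Imp d e) e"
      using 1 2 trans unfolding equ_def by blast
    then show ?thesis by simp
  qed (use 2 in simp)
qed

lemma Imp_node:
  assumes "node d" "\<not> leq P d e"
  shows "equ P (Imp d e) e"
  using Imp_cases[of e d] assms unfolding node_def incomp_def by blast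

text \<open>\<open>Imp d e\<close> is above \<open>e\<close> and not above \<open>d\<close>, so it
  is incomparable with \<open>d\<close> as well; uniqueness identifies it with
  \<open>e\<close>.\<close>

lemma Imp_incomp:
  assumes "incomp P d e"
  shows "equ P (Imp d e) e"
proof -
  have "incomp P d (Imp d e)"
    using assms leq_S[OF thy _ refl] leq_Imp[OF thy] trans unfolding incomp_def by blast
  then show ?thesis
    using assms unique_incomp by blast
qed

text \<open>\<open>Imp d (And d e)\<close> has the same value as \<open>Imp d e\<close>. Thus each
  middle element of a diamond is the pseudocomplement of the other relative to the bottom.\<close>

lemma Imp_And_incomp:
  assumes "incomp P d e"
  shows "equ P (Imp d (And d e)) e"
proof -
  have "equ P (Imp d (And d e)) (Imp d e)"
    using Imp_mono[OF thy refl leq_And_right[OF thy]] leq_And_right[OF thy, of "Imp d e" d]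
      mp_leq[OF thy, of d e]
    by (simp add: equ_def leq_Imp_iff leq_And_iff thy)
  then show ?thesis
    using Imp_incomp[OF assms] equ_trans thy by blast
qed

end

section \<open>Homomorphisms into Lindenbaum algebras\<close>

definition closed_fms :: "'v fm set \<Rightarrow> bool" where
  "closed_fms D \<longleftrightarrow> Bot \<in> D \<and> Top \<in> D \<and>
     (\<forall>p\<in>D. \<forall>q\<in>D. And p q \<in> D \<and> Or p q \<in> D \<and> Imp p q \<in> D)"

text \<open>\<open>k\<close> acts on formulas, and only its values are taken modulo
  \<open>F\<close>; compatibility with equivalence modulo \<open>P\<close> comes from the
  monotonicity required in \<open>hom_onI\<close>.\<close>

definition hom_on :: "'v fm set \<Rightarrow> 'u fm set \<Rightarrow> ('v fm \<Rightarrow> 'u fm) \<Rightarrow> bool" where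
  "hom_on D F k \<longleftrightarrow> equ F (k Bot) Bot \<and> equ F (k Top) Top \<and>
     (\<forall>p\<in>D. \<forall>q\<in>D. equ F (k (And p q)) (And (k p) (k q)) \<and>
        equ F (k (Or p q)) (Or (k p) (k q)) \<and> equ F (k (Imp p q)) (Imp (k p) (k q)))"

text \<open>A homomorphism is determined by its values at the variables, so it is a substitution
  modulo \<open>F\<close>. With \<open>k = id\<close> this becomes replacement of variables by
  equivalents.\<close>

lemma hom_on_subst:
  assumes F: "thy F" and D: "closed_fms D" and k: "hom_on D F k"
    and vars: "\<And>x. x \<in> vars q \<Longrightarrow> Var x \<in> D \<and> equ F (k (Var x)) (t x)"
  shows "q \<in> D \<and> equ F (k q) (subst t q)"
  using vars
proof (induction q)
  case (And p q)
  then have "p \<in> D" "q \<in> D" "equ F (k p) (subst t p)" "equ F (k q) (subst t q)"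
    by simp_all
  moreover from this have "equ F (k (And p q)) (And (k p) (k q))" "And p q \<in> D"
    using D k by (simp_all add: closed_fms_def hom_on_def)
  ultimately show ?case
    using equ_trans[OF F _ equ_And[OF F, of "k p" _ "k q"]] by simp
next
  case (Or p q)
  then have "p \<in> D" "q \<in> D" "equ F (k p) (subst t p)" "equ F (k q) (subst t q)"
    by simp_all
  moreover from this have "equ F (k (Or p q)) (Or (k p) (k q))" "Or p q \<in> D"
    using D k by (simp_all add: closed_fms_def hom_on_def)
  ultimately show ?case
    using equ_trans[OF F _ equ_Or[OF F, of "k p" _ "k q"]] by simp
next
  case (Imp p q)
  then have "p \<in> D" "q \<in> D" "equ F (k p) (subst t p)" "equ F (k q) (subst t q)"
    by simp_all
  moreover from this have "equ F (k (Imp p q)) (Imp (k p) (k q))" "Imp p q \<in> D"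
    using D k by (simp_all add: closed_fms_def hom_on_def)
  ultimately show ?case
    using equ_trans[OF F _ equ_Imp[OF F, of "k p" _ "k q"]] by simp
qed (use D k in \<open>auto simp: closed_fms_def hom_on_def\<close>)

context prime_diamond
begin

text \<open>Monotonicity settles meets and joins of comparable pairs and one half of those of
  incomparable pairs. An implication between elements in order is the top, and one half of every
  implication follows by applying \<open>k\<close> to modus ponens.\<close>

lemma hom_onI:
  assumes F: "thy F" and D: "closed_fms D"
    and mono: "\<And>p q. p \<in> D \<Longrightarrow> q \<in> D \<Longrightarrow> leq P p q \<Longrightarrow> leq F (k p) (k q)"
    and meet: "\<And>p q. p \<in> D \<Longrightarrow> q \<in> D \<Longrightarrow> incomp P p q \<Longrightarrow> leq F (And (k p) (k q)) (k (And p q))"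
    and join: "\<And>p q. p \<in> D \<Longrightarrow> q \<in> D \<Longrightarrow> incomp P p q \<Longrightarrow> leq F (k (Or p q)) (Or (k p) (k q))"
    and residual: "\<And>p q. p \<in> D \<Longrightarrow> q \<in> D \<Longrightarrow> \<not> leq P p q \<Longrightarrow> leq F (Imp (k p) (k q)) (k (Imp p q))"
    and Bot: "leq F (k Bot) Bot" and Top: "k Top \<in> F"
  shows "hom_on D F k"
proof -
  have And: "equ F (k (And p q)) (And (k p) (k q))" if pq: "p \<in> D" "q \<in> D" for p q
  proof -
    have A: "And p q \<in> D"
      using D pq by (simp add: closed_fms_def)
    have "leq F (And (k p) (k q)) (k (And p q))"
    proof -
      consider "leq P p q" | "leq P q p" | "incomp P p q"
        by (auto simp: incomp_def)
      then show ?thesis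
      proof cases
        case 1
        then have "leq F (k p) (k (And p q))"
          by (intro mono pq A) (simp add: leq_And_iff thy)
        then show ?thesis
          using leq_trans[OF F leq_And_left[OF F]] by blast
      next
        case 2
        then have "leq F (k q) (k (And p q))"
          by (intro mono pq A) (simp add: leq_And_iff thy)
        then show ?thesis
          using leq_trans[OF F leq_And_right[OF F]] by blast
      qed (rule meet[OF pq])
    qed
    moreover have "leq F (k (And p q)) (And (k p) (k q))"
      using mono[OF A pq(1)] mono[OF A pq(2)]
      by (simp add: thy F leq_And_iff leq_And_left leq_And_right)
    ultimately show ?thesis
      by (simp add: equ_def)
  qed
  moreover have "equ F (k (Or p q)) (Or (k p) (k q))" if pq: "p \<in> D" "q \<in> D" for p q
  proof -
    have A: "Or p q \<in> D"
      using D pq by (simp add: closed_fms_def)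
    have "leq F (k (Or p q)) (Or (k p) (k q))"
    proof -
      consider "leq P p q" | "leq P q p" | "incomp P p q"
        by (auto simp: incomp_def)
      then show ?thesis
      proof cases
        case 1
        then have "leq F (k (Or p q)) (k q)"
          by (intro mono pq A) (simp add: leq_Or_iff thy)
        then show ?thesis
          using leq_trans[OF F _ leq_Or_right[OF F]] by blast
      next
        case 2
        then have "leq F (k (Or p q)) (k p)"
          by (intro mono pq A) (simp add: leq_Or_iff thy)
        then show ?thesis
          using leq_trans[OF F _ leq_Or_left[OF F]] by blast
      qed (rule join[OF pq])
    qed
    moreover have "leq F (Or (k p) (k q)) (k (Or p q))"
      using mono[OF pq(1) A] mono[OF pq(2) A]
      by (simp add: thy F leq_Or_iff leq_Or_left leq_Or_right)
    ultimately show ?thesis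
      by (simp add: equ_def)
  qed
  moreover have "equ F (k (Imp p q)) (Imp (k p) (k q))" if pq: "p \<in> D" "q \<in> D" for p q
  proof -
    have A: "Imp p q \<in> D"
      using D pq by (simp add: closed_fms_def)
    have "leq F (Imp (k p) (k q)) (k (Imp p q))"
    proof (cases "leq P p q")
      case True
      then have "leq P Top (Imp p q)"
        using leq_of_mem[OF thy, of "Imp p q" Top] by (simp add: leq_def)
      then have "leq F (k Top) (k (Imp p q))"
        using mono A D by (simp add: closed_fms_def)
      then show ?thesis
        using leq_of_mem[OF F] leq_mp[OF F] Top by blast
    qed (rule residual[OF pq])
    moreover have "leq F (And (k (Imp p q)) (k p)) (k q)"
    proof (rule leq_trans[OF F])
      show "leq F (And (k (Imp p q)) (k p)) (k (And (Imp p q) p))"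
        using And[OF A pq(1)] by (simp add: equ_def)
      show "leq F (k (And (Imp p q) p)) (k q)"
        using A pq D by (intro mono mp_leq thy) (simp_all add: closed_fms_def)
    qed
    ultimately show ?thesis
      by (simp add: equ_def leq_Imp_iff F)
  qed
  ultimately show ?thesis
    using Bot Top F by (simp add: hom_on_def equ_def leq_of_mem)
qed

end

section \<open>Epimorphisms and the Beth property\<close>

text \<open>Semantic form: \<open>F\<close> stands for the target algebra and \<open>t\<close> for the second homomorphism.\<close>

definition implicitly_defines :: "'v fm set \<Rightarrow> 'v set \<Rightarrow> bool" where
  "implicitly_defines G Y \<longleftrightarrow> (\<forall>t F. thy F \<longrightarrow> G \<subseteq> F \<longrightarrow> subst t ` G \<subseteq> F \<longrightarrow>
     (\<forall>x. x \<notin> Y \<longrightarrow> t x = Var x) \<longrightarrow> (\<forall>x. equ F (Var x) (t x)))"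

lemma subst_Var [simp]: "subst Var p = p"
  by (induction p) simp_all

locale implicit_definition = prime_diamond P for P :: "'v fm set" +
  fixes G :: "'v fm set" and Y :: "'v set"
  assumes implicit: "implicitly_defines G Y" and GP: "G \<subseteq> P"
begin

definition definable :: "'v fm \<Rightarrow> bool" where
  "definable d \<longleftrightarrow> (\<exists>r. vars r \<inter> Y = {} \<and> equ P d r)"

section \<open>Closure properties of the definable formulas\<close>

lemma definable_equ: "equ P d e \<Longrightarrow> definable d \<Longrightarrow> definable e"
  unfolding definable_def using equ_trans[OF thy equ_sym] by blast

lemma definable_Bot: "definable Bot"
  by (auto simp: definable_def thy intro!: exI[of _ Bot])

lemma definable_Top: "definable Top"
  by (auto simp: definable_def thy intro!: exI[of _ Top])

lemma definable_mem: "q \<in> P \<Longrightarrow> definable q"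
  by (rule definable_equ[OF _ definable_Top]) (simp add: equ_def thy leq_of_mem)

lemma definable_Var: "x \<notin> Y \<Longrightarrow> definable (Var x)"
  by (auto simp: definable_def thy intro!: exI[of _ "Var x"])

lemma definable_And:
  assumes "definable d" "definable e" shows "definable (And d e)"
proof -
  obtain r s where "vars r \<inter> Y = {}" "vars s \<inter> Y = {}" "equ P d r" "equ P e s"
    using assms by (auto simp: definable_def)
  then show ?thesis
    unfolding definable_def by (intro exI[of _ "And r s"]) (auto simp: equ_And thy)
qed

lemma definable_Or:
  assumes "definable d" "definable e" shows "definable (Or d e)"
proof -
  obtain r s where "vars r \<inter> Y = {}" "vars s \<inter> Y = {}" "equ P d r" "equ P e s"
    using assms by (auto simp: definable_def)
  then show ?thesis
    unfolding definable_def by (intro exI[of _ "Or r s"]) (auto simp: equ_Or thy)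
qed

lemma definable_Imp:
  assumes "definable d" "definable e" shows "definable (Imp d e)"
proof -
  obtain r s where "vars r \<inter> Y = {}" "vars s \<inter> Y = {}" "equ P d r" "equ P e s"
    using assms by (auto simp: definable_def)
  then show ?thesis
    unfolding definable_def by (intro exI[of _ "Imp r s"]) (auto simp: equ_Imp thy)
qed

section \<open>Homomorphisms that fix the definable formulas\<close>

lemma subst_fixes:
  assumes F: "thy F" and "G \<subseteq> F" "subst t ` G \<subseteq> F" "\<And>x. x \<notin> Y \<Longrightarrow> t x = Var x"
  shows "equ F q (subst t q)"
proof -
  have "equ F (Var x) (t x)" for x
    using implicit assms unfolding implicitly_defines_def by blast
  then have "equ F (id q) (subst t q)"
    using hom_on_subst[of F UNIV id q t] F by (simp add: closed_fms_def hom_on_def)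
  then show ?thesis by simp
qed

text \<open>Modulo \<open>F\<close>, \<open>k\<close> is a substitution \<open>t\<close> that fixes
  the variables outside \<open>Y\<close>. Members of \<open>P\<close> are equivalent to
  \<open>Top\<close>, hence definable and fixed by \<open>k\<close>, so \<open>t\<close> sends
  \<open>G\<close> into \<open>F\<close> and implicit definability applies.\<close>

lemma hom_fixes:
  assumes F: "thy F" "P \<subseteq> F" and k: "hom_on UNIV F k"
    and fixed: "\<And>q. definable q \<Longrightarrow> k q = q"
  shows "equ F q (k q)"
proof -
  define t where "t x = (if x \<in> Y then k (Var x) else Var x)" for x
  have "t x = k (Var x)" for x
    by (simp add: t_def fixed definable_Var)
  then have k_subst: "equ F (k q) (subst t q)" for q
    using hom_on_subst[OF F(1) _ k, of q t] F(1) by (simp add: closed_fms_def)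
  have "subst t q \<in> F" if "q \<in> G" for q
    using k_subst[of q] fixed[OF definable_mem] GP F(2) that leq_mp[OF F(1)]
    unfolding equ_def by fastforce
  then have "equ F q (subst t q)"
    using GP F(2) by (intro subst_fixes[OF F(1)]) (auto simp: t_def)
  then show ?thesis
    using k_subst equ_trans[OF F(1)] equ_sym by blast
qed


text \<open>A monotone map that is its own inverse modulo \<open>P\<close> is its own left and right
  adjoint, so it preserves joins, meets and implications.\<close>

lemma involution_hom:
  assumes mono: "\<And>p q. leq P p q \<Longrightarrow> leq P (k p) (k q)" and inv: "\<And>p. equ P (k (k p)) p"
  shows "hom_on UNIV P k"
proof -
  have flip: "leq P p (k q)" if "leq P (k p) q" for p q
    using mono[OF that] inv[of p] trans unfolding equ_def by blast
  have flip': "leq P (k p) q" if "leq P p (k q)" for p q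
    using mono[OF that] inv[of q] trans unfolding equ_def by blast
  have meet: "leq P (And (k p) (k q)) (k (And p q))" for p q
    by (intro flip) (simp add: leq_And_iff thy flip' leq_And_left leq_And_right)
  show ?thesis
  proof (rule hom_onI[OF thy])
    show "leq P (k (Or p q)) (Or (k p) (k q))" for p q
      by (intro flip') (simp add: leq_Or_iff thy flip leq_Or_left leq_Or_right)
    show "leq P (Imp (k p) (k q)) (k (Imp p q))" for p q
    proof (intro flip)
      let ?X = "Imp (k p) (k q)"
      have "leq P (And (k ?X) p) (And (k ?X) (k (k p)))"
        using inv[of p] by (intro And_mono thy refl) (simp add: equ_def)
      moreover have "leq P (k (And ?X (k p))) q"
        by (intro flip') (simp add: mp_leq thy)
      ultimately show "leq P (k ?X) (Imp p q)"
        using meet trans by (simp add: leq_Imp_iff[OF thy]) blast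
    qed
    show "leq P (k Bot) Bot"
      by (intro flip') (simp add: thy)
    show "k Top \<in> P"
      using flip[of Top Top] by (simp add: thy Top_not_leq)
  qed (simp_all add: closed_fms_def mono meet)
qed

text \<open>By unique incomparability every other element has the same position relative to
  \<open>d\<close> and \<open>e\<close>, so exchanging the two is an automorphism. It fixes the
  definable formulas, so by \<open>hom_fixes\<close> it would have to be the identity.\<close>

lemma undefinable_swap:
  assumes de: "incomp P d e" and "\<not> definable d" "\<not> definable e"
  shows False
proof -
  define k where "k q = (if equ P q d then e else if equ P q e then d else q)" for q
  have cmp_e: "leq P q e \<or> leq P e q" if "\<not> equ P q d" for q
    using incomp_comparable[OF incomp_sym[OF de], of q] that equ_sym by blast
  have cmp_d: "leq P q d \<or> leq P d q" if "\<not> equ P q e" for q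
    using incomp_comparable[OF de, of q] that equ_sym by blast
  have [simp]: "\<not> equ P e d" "\<not> equ P d e"
    using de by (auto simp: equ_def incomp_def)
  have "leq P (k p) (k q)" if pq: "leq P p q" for p q
    unfolding k_def using cmp_e[of q] cmp_e[of p] cmp_d[of q] cmp_d[of p] pq de refl trans
    unfolding equ_def incomp_def by (smt (verit, best))
  moreover have "equ P (k (k p)) p" for p
    unfolding k_def by (auto simp: thy intro: equ_sym)
  ultimately have "hom_on UNIV P k"
    by (rule involution_hom)
  moreover have "k q = q" if "definable q" for q
    using definable_equ[OF _ that] assms(2,3) by (auto simp: k_def)
  ultimately have "equ P d (k d)"
    using hom_fixes[OF thy order.refl] by simp
  then show False
    by (simp add: k_def thy)
qed

text \<open>This theory collapses everything strictly above \<open>d\<close> to the top while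
  keeping \<open>d\<close> below it. A failure of modus ponens would exhibit \<open>d\<close> as the
  meet of \<open>Imp p q\<close> and \<open>p\<close>, neither of which lies below the
  other.\<close>

lemma thy_above:
  assumes "node d" "d \<notin> P" and no_meet: "\<And>a b. incomp P a b \<Longrightarrow> \<not> equ P d (And a b)"
  shows "thy {q. leq P d q \<and> \<not> leq P q d}" (is "thy ?F")
proof -
  have "q \<in> ?F" if pq: "Imp p q \<in> ?F" "p \<in> ?F" for p q
  proof -
    have dq: "leq P d q"
      using pq leq_S[OF thy] by blast
    moreover have "\<not> leq P q d"
    proof
      assume "leq P q d"
      then have "leq P (And (Imp p q) p) d"
        using mp_leq[OF thy] trans by blast
      moreover have "leq P (And (Imp p q) p) d \<Longrightarrow> leq P r p \<Longrightarrow> leq P r (Imp p q) \<Longrightarrow> leq P r d" for r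
        using trans[of r "And (Imp p q) p" d] by (simp add: leq_And_iff thy)
      ultimately have "incomp P (Imp p q) p"
        using pq refl unfolding incomp_def by blast
      moreover have "leq P d (And (Imp p q) p)"
        using pq by (simp add: leq_And_iff thy)
      ultimately show False
        using no_meet \<open>leq P (And (Imp p q) p) d\<close> by (simp add: equ_def)
    qed
    ultimately show ?thesis by simp
  qed
  moreover have "q \<in> ?F" if "q \<in> P" for q
    using leq_mp[OF thy] leq_of_mem[OF thy] assms(2) that by blast
  ultimately show ?thesis
    using thy unfolding thy_def by blast
qed

text \<open>The elements above \<open>d\<close> are collapsed to the top, once with and once without \<open>d\<close> itself.\<close>

lemma undefinable_node:
  assumes twins: "\<And>a b. incomp P a b \<Longrightarrow> definable a" and d: "\<not> definable d"
  shows False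
proof -
  let ?F = "{q. leq P d q \<and> \<not> leq P q d}"
  define k where "k q = (if equ P q d then Top else q)" for q
  have not_incomp: "\<not> incomp P q d" for q
    using twins incomp_sym d by blast
  have node: "node d"
    using not_incomp by (auto simp: node_def incomp_def)
  have definable: "definable (And a b)" "definable (Or a b)" if "incomp P a b" for a b
    using that twins incomp_sym definable_And definable_Or by blast+
  have not_equ: "\<not> equ P q d" if "definable q" for q
    using d definable_equ that by blast
  have dP: "d \<notin> P"
    using d definable_mem by blast
  have F: "thy ?F"
    using node dP definable(1) not_equ equ_sym by (intro thy_above) blast+
  have PF: "P \<subseteq> ?F"
    using leq_mp[OF thy] leq_of_mem[OF thy] dP by blast
  have F_le: "leq ?F p q" if "leq P p q" for p q
    using leq_mono[OF that PF] .
  have inflate: "leq P q (k q)" for q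
    by (simp add: k_def thy)
  have "hom_on UNIV ?F k"
  proof (rule hom_onI[OF F])
    show "leq ?F (k p) (k q)" if pq: "leq P p q" for p q
    proof -
      have "q \<in> ?F" if "equ P p d" "\<not> equ P q d"
        using that pq trans unfolding equ_def by blast
      then show ?thesis
        using F_le[OF pq] by (simp add: k_def F leq_of_mem)
    qed
    show "leq ?F (And (k p) (k q)) (k (And p q))" if pq: "incomp P p q" for p q
      using twins[OF pq] twins[OF incomp_sym[OF pq]] not_equ by (simp add: k_def F)
    show "leq ?F (k (Or p q)) (Or (k p) (k q))" if pq: "incomp P p q" for p q
      using definable(2)[OF pq] twins[OF pq] twins[OF incomp_sym[OF pq]] not_equ
      by (simp add: k_def F)
    show "leq ?F (Imp (k p) (k q)) (k (Imp p q))" if pq: "\<not> leq P p q" for p q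
    proof (cases "equ P q d")
      case False
      then show ?thesis
        using Imp_mono[OF thy inflate refl] inflate trans F_le by (metis k_def)
    next
      case True
      then have "\<not> leq P p d" "leq P q p"
        using pq not_incomp[of p] trans unfolding equ_def incomp_def by blast+
      \<comment> \<open>By \<open>Imp_cases\<close>, otherwise \<open>q\<close> would be the meet of
        an incomparable pair, which is definable, whereas \<open>d\<close> is not.\<close>
      then have "equ P (Imp p q) q"
        using Imp_cases[of q p] pq definable(1) not_equ True equ_trans[OF thy] by blast
      then have "equ P (Imp p q) d"
        using True equ_trans[OF thy] by blast
      then show ?thesis
        by (simp add: k_def F)
    qed
    show "leq ?F (k Bot) Bot"
      using not_equ[OF definable_Bot] F by (simp add: k_def)
    show "k Top \<in> ?F"
      using Top_mem[OF F] by (simp add: k_def)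
  qed (simp_all add: closed_fms_def)
  \<comment> \<open>As \<open>k d\<close> is \<open>Top\<close>, the agreement puts \<open>d\<close>
    in \<open>?F\<close>, that is, strictly above itself.\<close>
  then have "equ ?F d (k d)"
    by (rule hom_fixes[OF F PF]) (simp add: k_def not_equ)
  then have "leq ?F Top d"
    by (simp add: k_def thy equ_def)
  then have "d \<in> ?F"
    by (rule leq_mp[OF F _ Top_mem[OF F]])
  then show False by (simp add: thy)
qed

text \<open>
  Here \<open>m\<close> is not definable either, and \<open>[m, e]\<close> and \<open>[d, j]\<close> are collapsed.  By separation
  \<open>m\<close> is not the join of an incomparable pair, hence joins are preserved.  As \<open>e \<rightarrow> m\<close>
  is \<open>d\<close>, implication is preserved only if \<open>j\<close> becomes the top.
\<close>

lemma undefinable_half: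
  assumes de: "incomp P d e" and d: "\<not> definable d" and e: "definable e"
  shows False
proof -
  define m where "m = And d e"
  define j where "j = Or d e"
  let ?F = "{q. leq P j q}"
  define k where "k q = (if equ P q m then e else if equ P q d then Top else q)" for q
  have m: "leq P m d" "leq P m e" and j: "leq P d j" "leq P e j"
    by (simp_all add: m_def j_def thy leq_And_left leq_And_right leq_Or_left leq_Or_right)
  have nodes: "node m" "node j"
    using de by (auto simp: m_def j_def node_And node_Or)
  have le_m: "leq P q m \<longleftrightarrow> leq P q d \<and> leq P q e" for q
    by (simp add: m_def leq_And_iff thy)
  have j_le: "leq P j q \<longleftrightarrow> leq P d q \<and> leq P e q" for q
    by (simp add: j_def leq_Or_iff thy)
  have cmp_e: "leq P q e \<or> leq P e q" if "\<not> equ P q d" for q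
    using incomp_comparable[OF incomp_sym[OF de], of q] that equ_sym by blast
  have cmp_d: "leq P q d \<or> leq P d q" if "\<not> equ P q e" for q
    using incomp_comparable[OF de, of q] that equ_sym by blast
  have not_le: "\<not> leq P d e" "\<not> leq P e d"
    using de by (auto simp: incomp_def)
  have above_m: "leq P e q" if "leq P m q" "\<not> equ P q m" "\<not> equ P q d" for q
    using cmp_e[of q] cmp_d[of q] that not_le le_m trans unfolding equ_def by blast
  have above_d: "leq P j q" if "leq P d q" "\<not> equ P q d" for q
    using cmp_e[of q] that not_le j_le trans unfolding equ_def by blast
  have Imp_dm: "equ P (Imp d m) e"
    using Imp_And_incomp[OF de] by (simp add: m_def)
  have "equ P m (And e d)"
    by (simp add: m_def equ_def leq_And_iff leq_And_left leq_And_right thy)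
  then have Imp_em: "equ P (Imp e m) d"
    using Imp_And_incomp[OF incomp_sym[OF de]] equ_Imp[OF thy equ_refl[OF thy]] equ_trans[OF thy]
    by blast
  have "\<not> definable m"
    using definable_Imp[OF e] definable_equ[OF Imp_em] d by blast
  then have not_equ: "\<not> equ P q m" "\<not> equ P q d" if "definable q" for q
    using d definable_equ that by blast+
  have F: "thy ?F"
    by (rule thy_add[OF thy])
  have PF: "P \<subseteq> ?F"
    using leq_of_mem[OF thy] by blast
  have F_le: "leq ?F p q" if "leq P p q" for p q
    using leq_mono[OF that PF] .
  have inflate: "leq P q (k q)" for q
    by (auto simp: k_def thy equ_def intro: trans[OF _ m(2)])
  have k_id: "k q = q" if "definable q" for q
    using not_equ[OF that] by (simp add: k_def)
  have kd: "k q = Top" if "equ P q d" for q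
  proof -
    have "\<not> equ P q m"
      using that not_le(1) m(2) trans unfolding equ_def by blast
    then show ?thesis
      using that by (simp add: k_def)
  qed
  have km: "k q = e" if "equ P q m" for q
    using that by (simp add: k_def)
  have k_other: "k q = q" if "\<not> equ P q m" "\<not> equ P q d" for q
    using that by (simp add: k_def)
  have "hom_on UNIV ?F k"
  proof (rule hom_onI[OF F])
    show "leq ?F (k p) (k q)" if pq: "leq P p q" for p q
    proof -
      consider "equ P q d" | "equ P q m" | "\<not> equ P q d" "\<not> equ P q m"
        by blast
      then show ?thesis
      proof cases
        case 1
        then show ?thesis
          by (simp add: kd F)
      next
        case 2
        then have "leq P p m"
          using pq trans unfolding equ_def by blast
        then have "\<not> equ P p d"
          using not_le le_m trans unfolding equ_def by blast
        then have "leq P (k p) e"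
          using trans[OF \<open>leq P p m\<close> m(2)] by (simp add: k_def refl)
        then show ?thesis
          using F_le km[OF 2] by simp
      next
        case 3
        then have kq: "k q = q"
          by (simp add: k_other)
        consider "equ P p d" | "equ P p m" | "\<not> equ P p d" "\<not> equ P p m"
          by blast
        then show ?thesis
        proof cases
          case 1
          then have "leq P j q"
            using above_d pq 3 trans unfolding equ_def by blast
          then show ?thesis
            using leq_of_mem[OF F] kq by simp
        next
          case 2
          then have "leq P e q"
            using above_m pq 3 trans unfolding equ_def by blast
          then show ?thesis
            using F_le km[OF 2] kq by simp
        next
          case 3
          then show ?thesis
            using F_le pq kq by (simp add: k_other)
        qed
      qed
    qed
    show "leq ?F (And (k p) (k q)) (k (And p q))" if pq: "incomp P p q" for p q
    proof -
      \<comment> \<open>Up to equivalence the only incomparable pair containing \<open>d\<close> is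
        the diamond itself, where \<open>And Top e\<close> has to match the image \<open>e\<close>
        of \<open>m\<close>.\<close>
      have twin: "equ P b e" if "incomp P a b" "equ P a d" for a b
      proof -
        have "incomp P d b"
          using that trans unfolding incomp_def equ_def by blast
        then show ?thesis
          using unique_incomp[OF de] equ_sym by blast
      qed
      have not_m: "\<not> equ P p m" "\<not> equ P q m"
        using node_not_equ[OF nodes(1)] pq incomp_sym equ_sym by blast+
      consider "equ P p d" | "equ P q d" | "\<not> equ P p d" "\<not> equ P q d"
        by blast
      then show ?thesis
      proof cases
        case 1
        then have q: "equ P q e"
          using twin pq by blast
        then have "equ P (And p q) m"
          using 1 by (simp add: m_def equ_And thy)
        moreover have "k q = q"
          using q definable_equ[OF equ_sym e] k_id by blast
        ultimately show ?thesis
          using km leq_trans[OF F leq_And_right[OF F] F_le] q by (simp add: equ_def)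
      next
        case 2
        then have p: "equ P p e"
          using twin incomp_sym pq by blast
        then have "equ P (And p q) (And e d)"
          using 2 by (simp add: equ_And thy)
        then have "equ P (And p q) m"
          using \<open>equ P m (And e d)\<close> equ_sym equ_trans[OF thy] by blast
        moreover have "k p = p"
          using p definable_equ[OF equ_sym e] k_id by blast
        ultimately show ?thesis
          using km leq_trans[OF F leq_And_left[OF F] F_le] p by (simp add: equ_def)
      next
        case 3
        then show ?thesis
          using F_le[OF inflate] not_m by (simp add: k_other)
      qed
    qed
    show "leq ?F (k (Or p q)) (Or (k p) (k q))" if pq: "incomp P p q" for p q
    proof -
      \<comment> \<open>The join is not \<open>m\<close> by separation, and not \<open>d\<close>
        because it is a node.\<close>
      have "k (Or p q) = Or p q"
        using separated[OF de pq] node_not_equ[OF node_Or[OF pq] de] equ_sym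
        by (intro k_other) (auto simp: m_def)
      then show ?thesis
        using F_le[OF Or_mono[OF thy inflate inflate]] by simp
    qed
    show "leq ?F (Imp (k p) (k q)) (k (Imp p q))" if pq: "\<not> leq P p q" for p q
    proof -
      consider "equ P q d" | "equ P q m" | "\<not> equ P q d" "\<not> equ P q m"
        by blast
      then show ?thesis
      proof cases
        case 1
        then have "leq P d (Imp p q)"
          using leq_Imp[OF thy] trans unfolding equ_def by blast
        \<comment> \<open>Whatever lies above \<open>d\<close> either is equivalent to
          \<open>d\<close> and sent to \<open>Top\<close>, or lies above \<open>j\<close>.\<close>
        then have "k (Imp p q) \<in> ?F"
          using kd Top_mem[OF F] above_d trans[OF _ inflate] by (cases "equ P (Imp p q) d") auto
        then show ?thesis
          by (rule leq_of_mem[OF F])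
      next
        case 2
        then have Imp_m: "equ P (Imp p q) (Imp p m)"
          by (simp add: equ_Imp thy)
        have not_le_m: "\<not> leq P p m" and mp: "leq P m p"
          using 2 pq nodes(1) trans unfolding equ_def node_def by blast+
        consider "equ P p e" | "equ P p d" | "\<not> equ P p e" "\<not> equ P p d"
          by blast
        then show ?thesis
        proof cases
          case 1
          then have "equ P (Imp p m) (Imp e m)"
            by (simp add: equ_Imp thy)
          then have "equ P (Imp p q) d"
            using Imp_m Imp_em equ_trans[OF thy] by blast
          then show ?thesis
            by (simp add: kd F)
        next
          case p: 2
          then have "equ P (Imp p m) (Imp d m)"
            by (simp add: equ_Imp thy)
          then have "equ P (Imp p q) e"
            using Imp_m Imp_dm equ_trans[OF thy] by blast
          then have "leq P e (k (Imp p q))"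
            using inflate trans unfolding equ_def by blast
          moreover have "leq ?F (Imp Top e) e"
            using leq_S[OF F leq_refl[OF F] leq_Top[OF F]] .
          ultimately show ?thesis
            using km[OF 2] kd[OF p] F_le leq_trans[OF F] by auto
        next
          case 3
          then have "leq P e p"
            using above_m mp not_le_m by (auto simp: equ_def)
          then have "leq P d p"
            using cmp_d[OF 3(1)] not_le trans by blast
          \<comment> \<open>So \<open>p\<close> becomes the top, while \<open>Imp p m\<close> is
            below both \<open>d\<close> and \<open>e\<close>, hence equivalent to \<open>m\<close>,
            whose image is \<open>e\<close>.\<close>
          then have "leq P j p"
            using \<open>leq P e p\<close> j_le by blast
          then have "p \<in> ?F"
            by blast
          then have "leq ?F (Imp p e) e"
            using leq_S[OF F leq_refl[OF F]] leq_of_mem[OF F] by blast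
          moreover have "k p = p"
            using 3 not_le_m by (intro k_other) (auto simp: equ_def)
          moreover have "leq P (Imp p m) e" "leq P (Imp p m) d"
            using Imp_mono[OF thy _ refl] \<open>leq P d p\<close> \<open>leq P e p\<close> Imp_dm Imp_em trans
            unfolding equ_def by blast+
          then have "equ P (Imp p q) m"
            using Imp_m le_m leq_Imp[OF thy] trans unfolding equ_def by blast
          ultimately show ?thesis
            using km[OF 2] km by simp
        qed
      next
        case 3
        then show ?thesis
          using F_le[OF trans[OF Imp_mono[OF thy inflate refl] inflate]] by (simp add: k_other)
      qed
    qed
    show "leq ?F (k Bot) Bot"
      by (simp add: k_id definable_Bot F)
    show "k Top \<in> ?F"
      by (simp add: k_id definable_Top thy)
  qed (simp_all add: closed_fms_def)
  \<comment> \<open>Since \<open>k m\<close> is \<open>e\<close>, this puts \<open>Imp e m\<close>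
    above \<open>j\<close>, hence above \<open>e\<close>, which forces \<open>e\<close> below
    \<open>m\<close>.\<close>
  then have "equ ?F m (k m)"
    by (rule hom_fixes[OF F PF]) (rule k_id)
  then have "leq ?F e m"
    by (simp add: km thy equ_def)
  then have "leq P e (Imp e m)"
    using j(2) trans by (auto simp: leq_def[of ?F])
  then have "leq P e m"
    using leq_S[OF thy _ refl] by blast
  then show False
    using m(1) not_le trans by blast
qed

text \<open>If some incomparable pair has an undefinable member, \<open>undefinable_swap\<close> or
  \<open>undefinable_half\<close> applies, according to whether its twin is undefinable too;
  otherwise \<open>undefinable_node\<close> does.\<close>

lemma all_definable: "definable d"
  using undefinable_node undefinable_half undefinable_swap by blast

end

section \<open>Consequence in an intermediate logic\<close>

lemma subst_subst: "subst s (subst t p) = subst (\<lambda>x. subst s (t x)) p"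
  by (induction p) simp_all

lemma rename_subst: "rename f p = subst (\<lambda>x. Var (f x)) p"
  by (induction p) simp_all

lemma subst_cong: "(\<And>x. x \<in> vars p \<Longrightarrow> s x = t x) \<Longrightarrow> subst s p = subst t p"
  by (induction p) simp_all

lemma vars_subst: "vars (subst s p) = (\<Union>x\<in>vars p. vars (s x))"
  by (induction p) auto

lemma entails_subst: "entails L G p \<Longrightarrow> entails L (subst s ` G) (subst s p)"
  by (induction rule: entails.induct)
    (auto simp: subst_subst intro: entails.premise entails.thm_instance dest: entails.mp)

text \<open>Members of \<open>L\<close> have variables in \<open>nat\<close>, so each axiom over
  \<open>'v\<close> is obtained by substituting into its instance with the variables
  \<open>0\<close>, \<open>1\<close>, \<open>2\<close>.\<close>

lemma IPC_entails:
  fixes p :: "'v fm"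
  assumes L: "intermediate_logic L" and p: "p \<in> IPC"
  shows "entails L G p"
proof -
  have *: "entails L G (subst (\<lambda>n. if n = 0 then a else if n = 1 then b else c) q)"
    if "q \<in> IPC" for q :: "nat fm" and a b c :: "'v fm"
    using L that by (intro entails.thm_instance) (auto simp: intermediate_logic_def)
  show ?thesis
    using p
  proof (induction rule: IPC.induct)
    case (K p q)
    then show ?case
      using *[OF IPC.K[of "Var 0" "Var 1"], of p q] by simp
  next
    case (S p q r)
    then show ?case
      using *[OF IPC.S[of "Var 0" "Var 1" "Var 2"], of p q r] by simp
  next
    case (and_left p q)
    then show ?case
      using *[OF IPC.and_left[of "Var 0" "Var 1"], of p q] by simp
  next
    case (and_right p q)
    then show ?case
      using *[OF IPC.and_right[of "Var 0" "Var 1"], of p q] by simp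
  next
    case (and_intro p q)
    then show ?case
      using *[OF IPC.and_intro[of "Var 0" "Var 1"], of p q] by simp
  next
    case (or_left p q)
    then show ?case
      using *[OF IPC.or_left[of "Var 0" "Var 1"], of p q] by simp
  next
    case (or_right q p)
    then show ?case
      using *[OF IPC.or_right[of "Var 0" "Var 1"], of q p] by simp
  next
    case (or_elim p r q)
    then show ?case
      using *[OF IPC.or_elim[of "Var 0" "Var 1" "Var 2"], of p r q] by simp
  next
    case (bot_elim p)
    then show ?case
      using *[OF IPC.bot_elim[of "Var 0"], of p] by simp
  next
    case top_intro
    then show ?case
      using *[OF IPC.top_intro] by simp
  qed (rule entails.mp)
qed

lemma thy_entails: "intermediate_logic L \<Longrightarrow> thy {p. entails L G p}"
  unfolding thy_def using IPC_entails entails.mp by blast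

lemma entails_mem:
  assumes "entails L G p" "thy F" "G \<subseteq> F" and "\<And>p s. p \<in> L \<Longrightarrow> subst s p \<in> F"
  shows "p \<in> F"
  using assms(1) by induction (use assms(2-4) thy_mp in blast)+

definition diamond_logic :: "nat fm set \<Rightarrow> bool" where
  "diamond_logic L \<longleftrightarrow> intermediate_logic L \<and>
     unique_incomp_fm (Var 0) (Var 1) (Var 2) \<in> L \<and>
     separated_fm (Var 0) (Var 1) (Var 2) (Var 3) \<in> L"

lemma diamond_thy_entails:
  assumes "diamond_logic L"
  shows "diamond_thy {p. entails L G p}"
proof -
  \<comment> \<open>Indexing into the list serves as the substitution.\<close>
  have "entails L G (subst ((!) [p, q, r, s]) (unique_incomp_fm (Var 0) (Var 1) (Var 2)))"
    "entails L G (subst ((!) [p, q, r, s]) (separated_fm (Var 0) (Var 1) (Var 2) (Var 3)))" for p q r s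
    using assms by (auto simp: diamond_logic_def intro: entails.thm_instance)
  then have "entails L G (unique_incomp_fm p q r)" "entails L G (separated_fm p q r s)" for p q r s
    by (simp_all add: unique_incomp_fm_def separated_fm_def Let_def numeral_2_eq_2 numeral_3_eq_3)
  then show ?thesis
    using assms by (simp add: diamond_thy_def thy_entails diamond_logic_def)
qed

lemma diamond_thy_mono: "diamond_thy T \<Longrightarrow> thy F \<Longrightarrow> T \<subseteq> F \<Longrightarrow> diamond_thy F"
  unfolding diamond_thy_def by blast

section \<open>The infinite Beth property of diamond logics\<close>

text \<open>
  \<open>Q\<close> contains the \<open>Y\<close>-free consequences of \<open>a\<close> but not \<open>a\<close>; then \<open>P\<close> is generated by \<open>a\<close> and the
  \<open>Y\<close>-free part of \<open>Q\<close>, and can avoid all other \<open>Y\<close>-free formulas.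
\<close>

lemma separating_primes:
  assumes T: "thy T" and undef: "\<And>p. vars p \<inter> Y = {} \<Longrightarrow> \<not> equ T a p"
  obtains P Q where "prime_thy P" "prime_thy Q" "T \<subseteq> P" "T \<subseteq> Q" "a \<in> P" "a \<notin> Q"
    "\<And>p. vars p \<inter> Y = {} \<Longrightarrow> p \<in> P \<longleftrightarrow> p \<in> Q"
proof -
  have trans: "leq T p q \<Longrightarrow> leq T q r \<Longrightarrow> leq T p r" for p q r
    using leq_trans[OF T] by blast
  define S where "S = {q. \<exists>p. vars p \<inter> Y = {} \<and> leq T a p \<and> leq T p q}"
  have "q \<in> S" if S: "Imp p q \<in> S" "p \<in> S" for p q
  proof -
    obtain b c where bc: "vars b \<inter> Y = {}" "vars c \<inter> Y = {}" "leq T a b" "leq T a c"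
      "leq T b (Imp p q)" "leq T c p"
      using S by (auto simp: S_def)
    then have "leq T (And b c) (And (Imp p q) p)"
      by (simp add: And_mono T)
    then have "leq T (And b c) q"
      using mp_leq[OF T] trans by blast
    then show ?thesis
      using bc by (auto simp: S_def leq_And_iff T intro!: exI[of _ "And b c"])
  qed
  moreover have TS: "T \<subseteq> S"
    by (auto simp: S_def T leq_of_mem intro!: exI[of _ Top])
  ultimately have S: "thy S"
    using T unfolding thy_def by blast
  \<comment> \<open>Otherwise some \<open>Y\<close>-free formula lies both above and below
    \<open>a\<close>, against \<open>undef\<close>.\<close>
  have "S \<inter> {q. leq T q a} = {}"
    using undef trans by (auto simp: S_def equ_def)
  moreover have "Or p q \<in> {q. leq T q a}" if "p \<in> {q. leq T q a}" "q \<in> {q. leq T q a}" for p q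
    using that by (simp add: leq_Or_iff T)
  moreover have "{q. leq T q a} \<noteq> {}"
    using T Bot_leq by blast
  ultimately obtain Q where Q: "prime_thy Q" "S \<subseteq> Q" "Q \<inter> {q. leq T q a} = {}"
    using prime_extension[OF S, of "{q. leq T q a}"] by blast
  note thyQ = prime_thyD(1)[OF Q(1)]
  define R where "R = {q. \<exists>b\<in>Q. vars b \<inter> Y = {} \<and> leq T (And a b) q}"
  have "q \<in> R" if R: "Imp p q \<in> R" "p \<in> R" for p q
  proof -
    obtain b c where bc: "vars b \<inter> Y = {}" "vars c \<inter> Y = {}" "b \<in> Q" "c \<in> Q"
      "leq T (And a b) (Imp p q)" "leq T (And a c) p"
      using R by (auto simp: R_def)
    have "leq T (And a (And b c)) (And a b)" "leq T (And a (And b c)) (And a c)"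
      by (simp_all add: And_mono T leq_And_left leq_And_right)
    then have "leq T (And a (And b c)) q"
      using bc(5,6) leq_S[OF T] trans by blast
    then show ?thesis
      using bc(1-4) by (auto simp: R_def And_mem_iff thyQ intro!: bexI[of _ "And b c"])
  qed
  moreover have TR: "T \<subseteq> R"
    by (auto simp: R_def T leq_of_mem thyQ intro!: bexI[of _ Top])
  ultimately have R: "thy R"
    using T unfolding thy_def by blast
  let ?I = "{c. vars c \<inter> Y = {} \<and> c \<notin> Q}"
  \<comment> \<open>\<open>Imp b c\<close> is itself a \<open>Y\<close>-free consequence of
    \<open>a\<close>, hence in \<open>S\<close> and in \<open>Q\<close>.\<close>
  have "c \<in> Q" if c: "c \<in> R" "vars c \<inter> Y = {}" for c
  proof -
    obtain b where b: "b \<in> Q" "vars b \<inter> Y = {}" "leq T (And a b) c"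
      using c by (auto simp: R_def)
    then have "leq T a (Imp b c)"
      by (simp add: leq_Imp_iff T)
    then have "Imp b c \<in> S"
      using b c by (auto simp: S_def T intro!: exI[of _ "Imp b c"])
    then show ?thesis
      using b Q(2) thy_mp[OF thyQ] by blast
  qed
  then have RI: "R \<inter> ?I = {}"
    by blast
  have Or: "Or p q \<in> ?I" if "p \<in> ?I" "q \<in> ?I" for p q
    using that prime_thyD(3)[OF Q(1)] by auto
  have "?I \<noteq> {}"
    using prime_thyD(2)[OF Q(1)] by (auto intro!: exI[of _ Bot])
  from prime_extension[OF R Or this RI]
  obtain P where P: "prime_thy P" "R \<subseteq> P" "P \<inter> ?I = {}"
    by blast
  have "a \<in> R"
    by (auto simp: R_def T leq_And_left thyQ intro!: bexI[of _ Top])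
  moreover have "p \<in> P \<longleftrightarrow> p \<in> Q" if "vars p \<inter> Y = {}" for p
  proof
    assume "p \<in> Q"
    then have "p \<in> R"
      using that by (auto simp: R_def T leq_And_right)
    then show "p \<in> P"
      using P by blast
  qed (use P that in blast)
  moreover have "a \<notin> Q"
    using Q(3) T by (auto dest: equalityD1 simp: disjoint_iff)
  ultimately show ?thesis
    by (intro that[of P Q] P(1) Q(1) subset_trans[OF TS Q(2)] subset_trans[OF TR P(2)]
        subsetD[OF P(2)])
qed

text \<open>Suppose \<open>P\<close> and \<open>Q\<close> agree on \<open>Y\<close>-free formulas
  but only \<open>P\<close> contains \<open>Var y\<close>. Replacing the variables in
  \<open>Y\<close> by definitions valid modulo \<open>P\<close> sends \<open>T\<close> to
  \<open>Y\<close>-free members of \<open>P\<close>, hence into \<open>Q\<close>. Implicit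
  definability modulo \<open>Q\<close> then identifies \<open>Var y\<close> with its definition,
  which lies in \<open>P\<close> and so in \<open>Q\<close>.\<close>

lemma implicit_explicit:
  assumes T: "diamond_thy T" and implicit: "implicitly_defines T Y"
  shows "\<exists>p. vars p \<inter> Y = {} \<and> equ T (Var y) p"
proof (rule ccontr)
  assume "\<not> ?thesis"
  then have "\<not> equ T (Var y) p" if "vars p \<inter> Y = {}" for p
    using that by blast
  moreover have "thy T"
    using T by (simp add: diamond_thy_def)
  ultimately obtain P Q where PQ: "prime_thy P" "prime_thy Q" "T \<subseteq> P" "T \<subseteq> Q" "Var y \<in> P" "Var y \<notin> Q"
    and same: "\<And>p. vars p \<inter> Y = {} \<Longrightarrow> p \<in> P \<longleftrightarrow> p \<in> Q"
    using separating_primes by blast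
  note P = prime_thyD(1)[OF PQ(1)] and Q = prime_thyD(1)[OF PQ(2)]
  have diamond: "diamond_thy P" "diamond_thy Q"
    using diamond_thy_mono[OF T] P Q PQ(3,4) by blast+
  interpret P: implicit_definition P T Y
    by unfold_locales (use PQ diamond implicit in auto)
  interpret Q: implicit_definition Q T Y
    by unfold_locales (use PQ diamond implicit in auto)
  have "\<exists>p. vars p \<inter> Y = {} \<and> equ P (Var x) p" for x
    using P.all_definable by (simp add: P.definable_def)
  then obtain f where f: "\<And>x. vars (f x) \<inter> Y = {}" "\<And>x. equ P (Var x) (f x)"
    by metis
  define t where "t x = (if x \<in> Y then f x else Var x)" for x
  have t: "vars (t x) \<inter> Y = {}" "equ P (Var x) (t x)" for x
    using f by (auto simp: t_def P)
  have *: "equ P (id q) (subst t q)" for q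
    using hom_on_subst[of P UNIV id q t] P t by (simp add: closed_fms_def hom_on_def)
  have "subst t q \<in> Q" if "q \<in> T" for q
  proof -
    have "subst t q \<in> P"
      using *[of q] leq_mp[OF P] that PQ(3) by (auto simp: equ_def)
    then show ?thesis
      using same[of "subst t q"] t by (auto simp: vars_subst)
  qed
  then have "equ Q (Var y) (t y)"
    using Q.subst_fixes[of Q t "Var y"] Q PQ(4) by (auto simp: t_def image_subset_iff)
  moreover have "t y \<in> P"
    using t(2)[of y] leq_mp[OF P] PQ(5) unfolding equ_def by blast
  then have "t y \<in> Q"
    using same t(1) by blast
  ultimately show False
    using leq_mp[OF Q] PQ(6) unfolding equ_def by blast
qed

lemma infinite_beth_diamond_logic:
  assumes L: "diamond_logic L"
  shows "infinite_beth_property TYPE('v) L"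
  unfolding infinite_beth_property_def
proof (intro allI impI ballI)
  fix X Y :: "'v set" and G y
  assume "X \<inter> Y = {}" and G: "\<forall>p\<in>G. vars p \<subseteq> X \<union> Y"
    and beth: "\<forall>y\<in>Y. entails L
      (rename Inl ` G \<union> rename (\<lambda>v. if v \<in> Y then Inr v else Inl v) ` G)
      (Iff (Var (Inl y :: 'v + 'v)) (Var (Inr y)))"
    and y: "y \<in> Y"
  define T where "T = {p. entails L G p}"
  have GT: "G \<subseteq> T"
    by (auto simp: T_def intro: entails.premise)
  have "implicitly_defines T Y"
    unfolding implicitly_defines_def
  proof (intro allI impI)
    fix t F x
    assume F: "thy F" "T \<subseteq> F" "subst t ` T \<subseteq> F" and t: "\<forall>x. x \<notin> Y \<longrightarrow> t x = Var x"
    show "equ F (Var x) (t x)"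
    proof (cases "x \<in> Y")
      case True
      \<comment> \<open>This reads the two copies of the variables as the identity and as
        \<open>t\<close>, so that the two copies of \<open>G\<close> become \<open>G\<close> and its
        image under \<open>t\<close>.\<close>
      define s where "s = case_sum Var t"
      let ?G = "rename Inl ` G \<union> rename (\<lambda>v. if v \<in> Y then Inr v else Inl v) ` G"
      have s_Inl: "subst s (rename Inl q) = q" for q
        by (simp add: rename_subst subst_subst s_def)
      have s_Inr: "subst s (rename (\<lambda>v. if v \<in> Y then Inr v else Inl v) q) = subst t q" for q
      proof -
        have "(\<lambda>v. subst s (Var (if v \<in> Y then Inr v else Inl v))) = t"
          using t by (auto simp: s_def)
        then show ?thesis
          by (simp only: rename_subst subst_subst)
      qed
      have "entails L (subst s ` ?G) (subst s (Iff (Var (Inl x)) (Var (Inr x))))"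
        using beth True by (intro entails_subst) blast
      then have "subst s (Iff (Var (Inl x)) (Var (Inr x))) \<in> F"
      proof (rule entails_mem)
        show "subst s ` ?G \<subseteq> F"
          using s_Inl s_Inr F GT by (auto simp: image_Un image_image image_subset_iff)
        show "subst r p \<in> F" if "p \<in> L" for p r
          using F(2) that by (auto simp: T_def intro: entails.thm_instance)
      qed (rule F(1))
      then show ?thesis
        by (simp add: s_def Iff_mem_iff F(1))
    qed (simp add: t F(1))
  qed
  then obtain p where p: "vars p \<inter> Y = {}" "equ T (Var y) p"
    using implicit_explicit[OF diamond_thy_entails[OF L, of G]] unfolding T_def by blast
  \<comment> \<open>The formula \<open>p\<close> avoids \<open>Y\<close> but may use variables
    outside \<open>X\<close>; replacing them by \<open>Top\<close> leaves \<open>G\<close>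
    unchanged.\<close>
  define s where "s v = (if v \<in> X \<union> Y then Var v else Top)" for v
  have "subst s q = subst Var q" if "q \<in> G" for q
    by (rule subst_cong) (use G that in \<open>auto simp: s_def\<close>)
  then have "subst s ` G = G"
    by (simp add: image_def)
  moreover have "entails L G (Iff (Var y) p)"
    using p(2) Iff_mem_iff[of T] L by (simp add: T_def thy_entails diamond_logic_def)
  ultimately have "entails L G (subst s (Iff (Var y) p))"
    using entails_subst by metis
  then have "entails L G (Iff (Var y) (subst s p))"
    using y by (simp add: s_def)
  moreover have "vars (subst s p) \<subseteq> X"
    using p(1) by (auto simp: vars_subst s_def split: if_splits)
  ultimately show "\<exists>p. vars p \<subseteq> X \<and> entails L G (Iff (Var y) p)"
    by blast
qed

section \<open>Retractions onto finite diamond algebras\<close>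

context prime_diamond
begin

section \<open>Finite subalgebras of prime quotients\<close>

lemma node_equ: "node n \<Longrightarrow> equ P n d \<Longrightarrow> node d"
  unfolding node_def equ_def using trans by blast

text \<open>An element has at most one twin up to equivalence, and the twin of the twin is the
  element again, so one round of adding twins suffices.\<close>

lemma finite_twin_closure:
  assumes "finite V"
  obtains S where "finite S" "V \<subseteq> S"
    "\<And>r t. r \<in> S \<Longrightarrow> incomp P r t \<Longrightarrow> \<exists>t'\<in>S. equ P t t'"
proof -
  define twin where "twin p = (SOME q. incomp P p q)" for p
  have twin: "incomp P p (twin p)" if "incomp P p q" for p q
    unfolding twin_def using that by (rule someI)
  let ?S = "V \<union> twin ` {p \<in> V. \<exists>q. incomp P p q}"
  have "\<exists>t'\<in>?S. equ P t t'" if r: "r \<in> ?S" "incomp P r t" for r t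
  proof (cases "r \<in> V")
    case True
    then show ?thesis
      using unique_incomp[OF r(2) twin[OF r(2)]] r(2) by blast
  next
    case False
    then obtain p q where p: "p \<in> V" "r = twin p" "incomp P p q"
      using r(1) by blast
    then have "incomp P r p"
      using twin incomp_sym by blast
    then show ?thesis
      using unique_incomp[OF r(2)] p(1) by blast
  qed
  then show ?thesis
    using that[of ?S] assms by simp
qed

text \<open>After closing under twins, one round of meets and joins suffices: an incomparable pair
  produces nodes, which have no twins. By \<open>Imp_cases\<close> and \<open>Imp_incomp\<close> an
  implication is the top, its conclusion or a twin of its premise.\<close>

lemma finite_generation:
  assumes "finite V"
  obtains D S where "closed_fms D" "V \<subseteq> D" "\<And>d t. d \<in> D \<Longrightarrow> incomp P d t \<Longrightarrow> t \<in> D"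
    "finite S" "S \<subseteq> D" "\<And>d. d \<in> D \<Longrightarrow> \<exists>r\<in>S. equ P d r"
proof -
  obtain S where S: "finite S" "V \<union> {Bot, Top} \<subseteq> S"
    and twin: "\<And>r t. r \<in> S \<Longrightarrow> incomp P r t \<Longrightarrow> \<exists>t'\<in>S. equ P t t'"
    using finite_twin_closure[of "V \<union> {Bot, Top}"] assms by auto
  let ?B = "S \<union> (\<lambda>(p, q). And p q) ` (S \<times> S) \<union> (\<lambda>(p, q). Or p q) ` (S \<times> S)"
  let ?D = "{d. \<exists>r\<in>?B. equ P d r}"
  have D_equ: "d \<in> ?D" if "e \<in> ?D" "equ P d e" for d e
    using that equ_trans[OF thy] by blast
  have B: "S \<subseteq> ?D"
    using equ_refl[OF thy] by blast
  have non_node: "\<exists>r\<in>S. equ P d r" if d: "d \<in> ?D" "incomp P d t" for d t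
  proof -
    obtain r where r: "r \<in> ?B" "equ P d r"
      using d(1) by blast
    have not_node: "\<not> node r"
      using node_not_equ[of r d t] d(2) equ_sym[OF r(2)] by blast
    have "\<exists>r'\<in>S. equ P r r'"
    proof (cases "r \<in> S")
      case False
      then obtain p q where pq: "p \<in> S" "q \<in> S" "r = And p q \<or> r = Or p q"
        using r(1) by auto
      have "\<not> incomp P p q"
        using not_node pq(3) node_And node_Or by blast
      then have "leq P p q \<or> leq P q p"
        by (auto simp: incomp_def)
      then have "equ P r p \<or> equ P r q"
        using pq(3) refl by (auto simp: equ_def leq_And_iff leq_Or_iff leq_And_left leq_And_right
            leq_Or_left leq_Or_right thy)
      then show ?thesis
        using pq by blast
    qed (use equ_refl[OF thy] in blast)
    then show ?thesis
      using r(2) equ_trans[OF thy] by blast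
  qed
  have twin_D: "\<exists>t'\<in>S. equ P t t'" if d: "d \<in> ?D" "incomp P d t" for d t
  proof -
    obtain r where r: "r \<in> S" "equ P d r"
      using non_node[OF d] by blast
    then have "incomp P r t"
      using d(2) trans unfolding incomp_def equ_def by blast
    then show ?thesis
      using twin r(1) by blast
  qed
  have lattice: "And d e \<in> ?D \<and> Or d e \<in> ?D" if de: "d \<in> ?D" "e \<in> ?D" for d e
  proof -
    consider "leq P d e" | "leq P e d" | "incomp P d e"
      by (auto simp: incomp_def)
    then show ?thesis
    proof cases
      case 1
      then have "equ P (And d e) d" "equ P (Or d e) e"
        using refl by (auto simp: equ_def leq_And_iff leq_Or_iff leq_And_left leq_Or_right thy)
      then show ?thesis
        using D_equ de by blast
    next
      case 2
      then have "equ P (And d e) e" "equ P (Or d e) d"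
        using refl by (auto simp: equ_def leq_And_iff leq_Or_iff leq_And_right leq_Or_left thy)
      then show ?thesis
        using D_equ de by blast
    next
      case 3
      then obtain r s where rs: "r \<in> S" "s \<in> S" "equ P d r" "equ P e s"
        using non_node[OF de(1) 3] non_node[OF de(2) incomp_sym[OF 3]] by blast
      then have "equ P (And d e) (And r s)" "equ P (Or d e) (Or r s)"
        by (simp_all add: equ_And equ_Or thy)
      moreover have "And r s \<in> ?B" "Or r s \<in> ?B"
        using rs(1,2) by auto
      ultimately show ?thesis
        by blast
    qed
  qed
  have Imp: "Imp d e \<in> ?D" if de: "d \<in> ?D" "e \<in> ?D" for d e
  proof -
    consider "leq P d e" | "incomp P d e" | "leq P e d" "\<not> leq P d e"
      by (auto simp: incomp_def)
    then show ?thesis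
    proof cases
      case 1
      then have "equ P (Imp d e) Top"
        using leq_of_mem[OF thy, of "Imp d e" Top] by (simp add: equ_def thy leq_def[of P d])
      then show ?thesis
        using S(2) by blast
    next
      case 2
      then show ?thesis
        using D_equ[OF de(2)] Imp_incomp by blast
    next
      case 3
      from Imp_cases[OF this] show ?thesis
        using D_equ[OF de(2)] twin_D[OF de(1)] by blast
    qed
  qed
  show ?thesis
  proof (rule that)
    show "closed_fms ?D"
      using B S(2) lattice Imp by (simp add: closed_fms_def subset_iff)
    show "V \<subseteq> ?D"
      using B S(2) by blast
    show "finite ?B"
      using S(1) by simp
    show "?B \<subseteq> ?D"
      using equ_refl[OF thy] by blast
    show "t \<in> ?D" if "d \<in> ?D" "incomp P d t" for d t
      using twin_D[OF that] by blast
  qed blast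
qed

end

text \<open>The projection from formulas modulo \<open>F\<close> to formulas modulo \<open>P\<close>
  is to be split over the algebra \<open>D\<close> modulo \<open>P\<close>, which is finite because
  \<open>S\<close> represents all its classes.\<close>

locale retraction_context = prime_diamond P for P :: "'v fm set" +
  fixes F D S :: "'v fm set"
  assumes F: "thy F" "F \<subseteq> P" and D: "closed_fms D"
    and twin: "d \<in> D \<Longrightarrow> incomp P d t \<Longrightarrow> t \<in> D"
    and S: "finite S" "S \<subseteq> D" "d \<in> D \<Longrightarrow> \<exists>r\<in>S. equ P d r"
begin

lemma D_closed: "Bot \<in> D" "Top \<in> D"
  "\<lbrakk>p \<in> D; q \<in> D\<rbrakk> \<Longrightarrow> And p q \<in> D" "\<lbrakk>p \<in> D; q \<in> D\<rbrakk> \<Longrightarrow> Or p q \<in> D" "\<lbrakk>p \<in> D; q \<in> D\<rbrakk> \<Longrightarrow> Imp p q \<in> D"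
  using D by (auto simp: closed_fms_def)

lemmas transF = leq_trans[OF F(1)]

text \<open>
  The clauses are the hypotheses of \<open>hom_onI\<close>, restricted to the elements below \<open>n\<close>.  The last one
  depends on the formula \<open>n\<close> and not just on its class: a formula equivalent to \<open>Top\<close> modulo \<open>P\<close>
  need not be in \<open>F\<close>.
\<close>

definition section_below :: "'v fm \<Rightarrow> ('v fm \<Rightarrow> 'v fm) \<Rightarrow> bool" where
  "section_below n k \<longleftrightarrow>
     (\<forall>d\<in>D. \<forall>e\<in>D. leq P d e \<longrightarrow> leq P e n \<longrightarrow> leq F (k d) (k e)) \<and>
     (\<forall>d\<in>D. \<forall>e\<in>D. leq P d n \<longrightarrow> leq P e n \<longrightarrow> incomp P d e \<longrightarrow>
        leq F (And (k d) (k e)) (k (And d e)) \<and> leq F (k (Or d e)) (Or (k d) (k e))) \<and>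
     (\<forall>d\<in>D. \<forall>e\<in>D. leq P d n \<longrightarrow> leq P e n \<longrightarrow> \<not> leq P d e \<longrightarrow>
        leq F (Imp (k d) (k e)) (k (Imp d e))) \<and>
     (\<forall>d\<in>D. leq P d n \<longrightarrow> equ P (k d) d) \<and>
     leq F (k Bot) Bot \<and> (n = Top \<longrightarrow> k n \<in> F)"

lemma section_belowD:
  assumes "section_below n k"
  shows "\<lbrakk>d \<in> D; e \<in> D; leq P d e; leq P e n\<rbrakk> \<Longrightarrow> leq F (k d) (k e)"
    "\<lbrakk>d \<in> D; e \<in> D; leq P d n; leq P e n; incomp P d e\<rbrakk> \<Longrightarrow> leq F (And (k d) (k e)) (k (And d e))"
    "\<lbrakk>d \<in> D; e \<in> D; leq P d n; leq P e n; incomp P d e\<rbrakk> \<Longrightarrow> leq F (k (Or d e)) (Or (k d) (k e))"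
    "\<lbrakk>d \<in> D; e \<in> D; leq P d n; leq P e n; \<not> leq P d e\<rbrakk> \<Longrightarrow> leq F (Imp (k d) (k e)) (k (Imp d e))"
    "\<lbrakk>d \<in> D; leq P d n\<rbrakk> \<Longrightarrow> equ P (k d) d"
    "leq F (k Bot) Bot" "n = Top \<Longrightarrow> k n \<in> F"
  using assms by (auto simp: section_below_def)

text \<open>Keeps implications within the domain of the section built so far. Otherwise
  \<open>w\<close>, hence \<open>d\<close>, would lie below \<open>Imp d e\<close>, which puts
  \<open>d\<close> below \<open>e\<close>.\<close>

lemma Imp_below_node:
  assumes "node w" "leq P d w" "\<not> leq P d e"
  shows "leq P (Imp d e) w"
proof (rule ccontr)
  assume "\<not> ?thesis"
  then have "leq P d (Imp d e)"
    using assms trans unfolding node_def by blast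
  then show False
    using assms(3) leq_S[OF thy _ refl] by blast
qed

lemma section_Bot:
  assumes "equ P n Bot"
  shows "section_below n (\<lambda>_. Bot)"
proof -
  have "equ P d Bot" if "leq P d n" for d
    using that assms trans[of d n Bot] by (auto simp: equ_def thy)
  moreover from this have "leq P d e" if "leq P d n" for d e
    using that trans[of d Bot e] by (auto simp: equ_def thy)
  moreover have "n \<noteq> Top"
    using assms prime_thyD(2)[OF prime] Top_not_leq by (auto simp: equ_def)
  ultimately show ?thesis
    by (auto simp: section_below_def F incomp_def intro: equ_sym)
qed

text \<open>In other words, \<open>n \<or> (n \<rightarrow> u)\<close> is dense relative to \<open>u\<close>, as nodes above \<open>u\<close> have to be.\<close>

lemma Imp_relative_density:
  assumes "leq F s u"
  shows "leq F (Imp (Or n (Imp n u)) s) s"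
proof -
  let ?N = "Or n (Imp n u)"
  let ?X = "Imp ?N s"
  have "leq F ?X (Imp n u)"
    using Imp_mono[OF F(1) leq_Or_left[OF F(1)] assms] .
  then have "leq F ?X ?N"
    using transF leq_Or_right[OF F(1)] by blast
  then show ?thesis
    using leq_S[OF F(1) leq_refl[OF F(1)]] by blast
qed

text \<open>The value at \<open>n\<close> is \<open>N\<close>. Modulo \<open>P\<close> its second
  disjunct is equivalent to \<open>w\<close>, so \<open>N\<close> is equivalent to \<open>n\<close>;
  modulo \<open>F\<close> that disjunct lifts \<open>N\<close> above the image of \<open>w\<close>
  and, by \<open>Imp_relative_density\<close>, makes implications from \<open>n\<close> come out
  right.\<close>

lemma section_cover:
  assumes n: "node n" and w: "node w" "w \<in> D" "leq P w n" "\<not> leq P n w"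
    and cover: "\<And>d. d \<in> D \<Longrightarrow> leq P d n \<Longrightarrow> \<not> leq P n d \<Longrightarrow> leq P d w"
    and k: "section_below w k"
  shows "\<exists>k'. section_below n k'"
proof -
  note k = section_belowD[OF k]
  define N where "N = Or n (Imp n (k w))"
  define k' where "k' d = (if equ P d n then N else k d)" for d
  have dichotomy: "equ P d n \<or> leq P d w" if "d \<in> D" "leq P d n" for d
    using cover that by (auto simp: equ_def)
  have k'w: "k' d = k d" if "leq P d w" for d
    using w(4) that trans by (auto simp: k'_def equ_def)
  have k'n: "k' d = N" if "equ P d n" for d
    using that by (simp add: k'_def)
  have le_N: "leq F (k d) N" if "d \<in> D" "leq P d w" for d
    unfolding N_def
    by (rule transF[OF transF[OF k(1)[OF that(1) w(2) that(2) refl] leq_Imp[OF F(1)]] leq_Or_right[OF F(1)]])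
  have "leq F (k' d) (k' e)" if de: "d \<in> D" "e \<in> D" "leq P d e" "leq P e n" for d e
  proof (cases "equ P e n")
    case True
    have "equ P d n \<or> leq P d w"
      using dichotomy de trans by blast
    then show ?thesis
      using k'n[OF True] k'n k'w le_N de(1) F(1) by auto
  next
    case False
    then have "leq P e w"
      using dichotomy de by blast
    then show ?thesis
      using k(1)[OF de(1-3)] k'w trans[OF de(3)] by auto
  qed
  moreover have "leq F (And (k' d) (k' e)) (k' (And d e)) \<and> leq F (k' (Or d e)) (Or (k' d) (k' e))"
    if de: "d \<in> D" "e \<in> D" "leq P d n" "leq P e n" "incomp P d e" for d e
  proof -
    have "\<not> equ P d n" "\<not> equ P e n"
      using node_not_equ[OF n] de(5) incomp_sym equ_sym by blast+
    then have "leq P d w" "leq P e w"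
      using dichotomy de by blast+
    moreover from this have "leq P (And d e) w" "leq P (Or d e) w"
      using trans[OF leq_And_left[OF thy]] by (auto simp: leq_Or_iff thy)
    ultimately show ?thesis
      using k(2,3) de k'w by auto
  qed
  moreover have "leq F (Imp (k' d) (k' e)) (k' (Imp d e))"
    if de: "d \<in> D" "e \<in> D" "leq P d n" "leq P e n" "\<not> leq P d e" for d e
  proof -
    have e: "leq P e w"
      using dichotomy[OF de(2,4)] de trans unfolding equ_def by blast
    show ?thesis
    proof (cases "leq P d w")
      case True
      then show ?thesis
        using Imp_below_node[OF w(1) True de(5)] k(4)[OF de(1,2) True e de(5)] k'w e by simp
    next
      case False
      then have d: "equ P d n"
        using dichotomy de by blast
      then have Imp: "equ P (Imp d e) e"
        using Imp_node node_equ[OF n equ_sym] de(5) by blast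
      then have "leq P (Imp d e) w"
        using e trans unfolding equ_def by blast
      moreover from this have "leq F (k e) (k (Imp d e))"
        using k(1)[OF de(2) D_closed(5)[OF de(1,2)]] Imp by (simp add: equ_def)
      moreover have "leq F (Imp N (k e)) (k e)"
        unfolding N_def by (rule Imp_relative_density) (rule k(1)[OF de(2) w(2) e refl])
      ultimately show ?thesis
        using k'w k'n[OF d] e transF by metis
    qed
  qed
  moreover have "equ P (k' d) d" if d: "d \<in> D" "leq P d n" for d
  proof (cases "equ P d n")
    case True
    have "equ P (Imp n (k w)) w"
      using equ_trans[OF thy equ_Imp[OF thy equ_refl[OF thy] k(5)[OF w(2) refl]] Imp_node[OF n w(4)]] .
    then have "equ P N n"
      using w(3) trans unfolding N_def equ_def by (auto simp: leq_Or_iff leq_Or_left thy)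
    then show ?thesis
      using k'n[OF True] True equ_trans[OF thy] equ_sym by metis
  next
    case False
    then have "leq P d w"
      using dichotomy d by blast
    then show ?thesis
      using k(5)[OF d(1)] k'w by simp
  qed
  moreover have "leq F (k' Bot) Bot"
    using k(6) k'w[of Bot] by (simp add: thy)
  moreover have "k' n \<in> F" if "n = Top"
    using that leq_mp[OF F(1) leq_Or_left[OF F(1)] Top_mem[OF F(1)]] by (simp add: k'_def thy N_def)
  ultimately show ?thesis
    unfolding section_below_def by blast
qed


text \<open>
  Relative to the image \<open>u\<close> of the lower node, \<open>b \<rightarrow> u\<close> and \<open>(b \<rightarrow> u) \<rightarrow> u\<close> are pseudocomplements of
  each other, like the two elements of a diamond.
\<close>

lemma section_diamond:
  assumes ab: "a \<in> D" "b \<in> D" "incomp P a b" and n: "equ P n (Or a b)"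
    and k: "section_below (And a b) k"
  shows "\<exists>k'. section_below n k'"
proof -
  note k = section_belowD[OF k]
  define m where "m = And a b"
  define u where "u = k m"
  \<comment> \<open>Modulo \<open>P\<close>, \<open>u\<close> is equivalent to \<open>m\<close>, so
    by \<open>Imp_And_incomp\<close> \<alpha> is equivalent to \<open>a\<close> and \<beta> to
    \<open>b\<close>.\<close>
  define \<alpha> where "\<alpha> = Imp b u"
  define \<beta> where "\<beta> = Imp \<alpha> u"
  define k' where "k' d = (if leq P d m then k d else if equ P d a then \<alpha>
    else if equ P d b then \<beta> else Or \<alpha> \<beta>)" for d
  have mD: "m \<in> D"
    using ab D_closed by (simp add: m_def)
  have m: "leq P m a" "leq P m b" "node m"
    using node_And[OF ab(3)] by (simp_all add: m_def thy leq_And_left leq_And_right)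
  have m_swap: "equ P m (And b a)"
    by (simp add: m_def equ_def leq_And_iff leq_And_left leq_And_right thy)
  have "equ P (Or a b) (Or b a)"
    by (simp add: equ_def leq_Or_iff leq_Or_left leq_Or_right thy)
  then have n_swap: "equ P n (Or b a)"
    by (rule equ_trans[OF thy n])
  have le_m: "leq P d m \<longleftrightarrow> leq P d a \<and> leq P d b" for d
    by (simp add: m_def leq_And_iff thy)
  have n_le: "leq P n d \<longleftrightarrow> leq P a d \<and> leq P b d" for d
  proof -
    have "leq P n d \<longleftrightarrow> leq P (Or a b) d"
      using n trans unfolding equ_def by blast
    then show ?thesis
      by (simp add: leq_Or_iff thy)
  qed
  have an: "leq P a n" "leq P b n"
    using n_le refl by blast+
  have not_le: "\<not> leq P a b" "\<not> leq P b a"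
    using ab(3) by (auto simp: incomp_def)
  have cases: "leq P d m \<or> equ P d a \<or> equ P d b \<or> equ P d n" if "leq P d n" for d
    using incomp_comparable[OF ab(3), of d] incomp_comparable[OF incomp_sym[OF ab(3)], of d]
      not_le that le_m n_le trans unfolding equ_def by blast
  have k'm: "k' d = k d" if "leq P d m" for d
    using that by (simp add: k'_def)
  have k'a: "k' d = \<alpha>" if "equ P d a" for d
    using that not_le le_m trans unfolding k'_def equ_def by metis
  have k'b: "k' d = \<beta>" if "equ P d b" for d
    using that not_le le_m trans unfolding k'_def equ_def by metis
  have k'n: "k' d = Or \<alpha> \<beta>" if "equ P d n" for d
  proof -
    have "leq P a d" "leq P b d"
      using that an trans unfolding equ_def by blast+
    then have "\<not> leq P d a" "\<not> leq P d b"
      using not_le trans by blast+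
    then show ?thesis
      by (simp add: k'_def le_m equ_def)
  qed
  note reflF = leq_refl[OF F(1)]
  have u\<alpha>: "leq F u \<alpha>" and u\<beta>: "leq F u \<beta>"
    by (simp_all add: \<alpha>_def \<beta>_def F leq_Imp)
  have b\<beta>: "leq F b \<beta>"
    using leq_S[OF F(1) leq_And_right[OF F(1)] leq_And_left[OF F(1)], of b u]
    by (simp add: \<alpha>_def \<beta>_def leq_Imp_iff F)
  have \<alpha>\<beta>: "leq F (And \<alpha> \<beta>) u"
    using leq_S[OF F(1) leq_And_right[OF F(1)] leq_And_left[OF F(1)]] unfolding \<beta>_def .
  \<comment> \<open>Triple pseudocomplements relative to \<open>u\<close> reduce to single
    ones.\<close>
  have Imp_\<beta>u: "leq F (Imp \<beta> u) \<alpha>"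
    unfolding \<alpha>_def by (rule Imp_mono[OF F(1) b\<beta> reflF])
  have contract: "leq F (Imp x (Imp x y)) (Imp x y)" for x y
    using leq_S[OF F(1) leq_S[OF F(1) leq_And_left[OF F(1)] leq_And_right[OF F(1)]] leq_And_right[OF F(1)]]
    by (simp add: leq_Imp_iff F)
  have Imp_\<alpha>\<beta>: "leq F (Imp \<alpha> \<beta>) \<beta>"
    unfolding \<beta>_def by (rule contract)
  have Imp_\<beta>\<alpha>: "leq F (Imp \<beta> \<alpha>) \<alpha>"
  proof -
    have "leq F (Imp \<beta> \<alpha>) (Imp b \<alpha>)"
      by (rule Imp_mono[OF F(1) b\<beta> reflF])
    then show ?thesis
      using contract transF unfolding \<alpha>_def by blast
  qed
  have \<alpha>_Or: "leq F \<alpha> (Or \<alpha> \<beta>)" and \<beta>_Or: "leq F \<beta> (Or \<alpha> \<beta>)"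
    by (simp_all add: F leq_Or_left leq_Or_right)
  have k_le_u: "leq F (k d) u" if "d \<in> D" "leq P d m" for d
    unfolding u_def using k(1)[OF that(1) mD that(2)] refl by (simp add: m_def)
  have k_mono: "leq F (k d) (k e)" if "d \<in> D" "e \<in> D" "leq P d e" "leq P e m" for d e
    using k(1)[OF that(1-3)] that(4) by (simp add: m_def)
  have u_k': "leq F u (k' d)" if "leq P d n" "\<not> leq P d m" for d
    using cases[OF that(1)] that(2) k'a k'b k'n u\<alpha> u\<beta> transF[OF u\<alpha> \<alpha>_Or] by auto
  have above_m: "leq P m d" if "leq P d n" "\<not> leq P d m" for d
    using m(3) that unfolding node_def by blast
  have mono: "leq F (k' d) (k' e)" if de: "d \<in> D" "e \<in> D" "leq P d e" "leq P e n" for d e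
  proof (cases "leq P e m")
    case True
    then show ?thesis
      using k_mono[OF de(1-3)] k'm trans[OF de(3)] by simp
  next
    case e: False
    show ?thesis
    proof (cases "leq P d m")
      case True
      then show ?thesis
        using transF[OF k_le_u[OF de(1)] u_k'[OF de(4) e]] k'm by simp
    next
      case False
      have dn: "leq P d n"
        using de(3,4) trans by blast
      have "equ P e n \<or> equ P d e"
        using cases[OF dn] cases[OF de(4)] False e de(3) not_le n_le trans
        unfolding equ_def by blast
      moreover have "k' d = k' e" if "equ P d e"
        using that cases[OF dn] False k'a k'b k'n equ_trans[OF thy equ_sym[OF that]] by metis
      moreover have "leq F (k' d) (Or \<alpha> \<beta>)"
        using cases[OF dn] False k'a k'b k'n \<alpha>_Or \<beta>_Or reflF by auto
      ultimately show ?thesis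
        using k'n reflF by auto
    qed
  qed
  moreover have "leq F (And (k' d) (k' e)) (k' (And d e)) \<and> leq F (k' (Or d e)) (Or (k' d) (k' e))"
    if de: "d \<in> D" "e \<in> D" "leq P d n" "leq P e n" "incomp P d e" for d e
  proof -
    consider "leq P d m" "leq P e m" | "equ P d a" "equ P e b" | "equ P d b" "equ P e a"
      using cases[OF de(3)] cases[OF de(4)] de m n_le trans unfolding incomp_def equ_def by blast
    then show ?thesis
    proof cases
      case 1
      then have "leq P (And d e) m" "leq P (Or d e) m"
        using trans[OF leq_And_left[OF thy]] by (auto simp: leq_Or_iff thy)
      then show ?thesis
        using k(2,3)[OF de(1,2) _ _ de(5)] 1 k'm by (simp add: m_def)
    next
      case 2
      then have "equ P (And d e) m" and "equ P (Or d e) n"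
        using equ_And[OF thy 2] equ_trans[OF thy equ_Or[OF thy 2] equ_sym[OF n]] by (simp_all add: m_def)
      then have "leq F u (k' (And d e))" "k' (Or d e) = Or \<alpha> \<beta>"
        using k_mono[OF mD D_closed(3)[OF de(1,2)]] k'm k'n by (auto simp: u_def equ_def)
      then show ?thesis
        using transF[OF \<alpha>\<beta>] k'a[OF 2(1)] k'b[OF 2(2)] reflF by simp
    next
      case 3
      then have "equ P (And d e) (And b a)" "equ P (Or d e) (Or b a)"
        by (simp_all add: equ_And equ_Or thy)
      then have "equ P (And d e) m" "equ P (Or d e) n"
        using m_swap n_swap equ_trans[OF thy _ equ_sym] by blast+
      then have "leq F u (k' (And d e))" "k' (Or d e) = Or \<alpha> \<beta>"
        using k_mono[OF mD D_closed(3)[OF de(1,2)]] k'm k'n by (auto simp: u_def equ_def)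
      moreover have "leq F (And \<beta> \<alpha>) u"
        using transF[OF _ \<alpha>\<beta>] by (simp add: leq_And_iff leq_And_left leq_And_right F)
      moreover have "leq F (Or \<alpha> \<beta>) (Or \<beta> \<alpha>)"
        by (simp add: leq_Or_iff leq_Or_left leq_Or_right F)
      ultimately show ?thesis
        using transF k'b[OF 3(1)] k'a[OF 3(2)] by auto
    qed
  qed
  moreover have "leq F (Imp (k' d) (k' e)) (k' (Imp d e))"
    if de: "d \<in> D" "e \<in> D" "leq P d n" "leq P e n" "\<not> leq P d e" for d e
  proof (cases "leq P d m")
    case True
    moreover have "leq P e m"
      using True de(5) m(3) trans unfolding node_def by blast
    ultimately show ?thesis
      using Imp_below_node[OF m(3) True de(5)] k(4)[OF de(1,2) _ _ de(5)] k'm by (simp add: m_def)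
  next
    case d: False
    note md = above_m[OF de(3) d] and ud = u_k'[OF de(3) d]
    have tD: "Imp d e \<in> D"
      using D_closed de by simp
    have anti: "leq P (Imp d e) (Imp c e)" if "leq P c d" for c
      using Imp_mono[OF thy that refl] .
    have antiF: "leq F (Imp (k' d) x) (Imp y x)" if "leq F y (k' d)" for x y
      using Imp_mono[OF F(1) that reflF] .
    have \<alpha>d: "leq F \<alpha> (k' d)" if "leq P a d"
      using cases[OF de(3)] d that not_le k'a k'n \<alpha>_Or reflF trans unfolding equ_def by metis
    have \<beta>d: "leq F \<beta> (k' d)" if "leq P b d"
      using cases[OF de(3)] d that not_le k'b k'n \<beta>_Or reflF trans unfolding equ_def by metis
    consider "leq P e m" "\<not> leq P m e" | "equ P e m" | "equ P e a" | "equ P e b"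
      using cases[OF de(4)] de trans unfolding equ_def by blast
    then show ?thesis
    proof cases
      case 1
      \<comment> \<open>As \<open>k' d\<close> lies above \<open>u\<close>,
        \<open>Imp (k' d) (k e)\<close> lies below \<open>Imp u (k e)\<close>, which the section
        below \<open>m\<close> already controls.\<close>
      then have Imp_m: "equ P (Imp m e) e"
        using Imp_node m(3) by blast
      then have "leq P (Imp m e) m" "leq P (Imp m e) (Imp d e)" "leq P (Imp d e) m"
        using 1(1) leq_Imp[OF thy] anti[OF md] trans unfolding equ_def by blast+
      then have "leq F (k (Imp m e)) (k' (Imp d e))"
        using k_mono[OF D_closed(5)[OF mD de(2)] tD] k'm by simp
      moreover have "leq F (Imp u (k e)) (k (Imp m e))"
        using k(4)[OF mD de(2)] 1 refl by (simp add: m_def u_def)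
      ultimately show ?thesis
        using antiF[OF ud] k'm[OF 1(1)] transF by metis
    next
      case 2
      have Imp_am: "equ P (Imp a m) b"
        using Imp_And_incomp[OF ab(3)] by (simp add: m_def)
      have Imp_bm: "equ P (Imp b m) a"
        using m_swap Imp_And_incomp[OF incomp_sym[OF ab(3)]] equ_Imp[OF thy equ_refl[OF thy]]
          equ_trans[OF thy] by blast
      have k'e: "leq F (k' e) u"
        using k_le_u[OF de(2)] 2 k'm by (simp add: equ_def)
      have Imp_u: "leq F (Imp (k' d) (k' e)) (Imp x u)" if "leq F x (k' d)" for x
        using Imp_mono[OF F(1) that k'e] .
      have Imp_e: "equ P (Imp d e) (Imp c m)" if "equ P d c" for c
        using equ_Imp[OF thy that 2] .
      consider "equ P d a" | "equ P d b" | "equ P d n"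
        using cases[OF de(3)] d by blast
      then show ?thesis
      proof cases
        case 1
        then have "k' (Imp d e) = \<beta>"
          using Imp_e Imp_am equ_trans[OF thy] k'b by blast
        then show ?thesis
          using Imp_u[OF \<alpha>d] 1 by (simp add: \<beta>_def equ_def)
      next
        case 2
        then have "k' (Imp d e) = \<alpha>"
          using Imp_e Imp_bm equ_trans[OF thy] k'a by blast
        then show ?thesis
          using transF[OF Imp_u[OF \<beta>d] Imp_\<beta>u] 2 by (simp add: equ_def)
      next
        case 3
        then have abd: "leq P a d" "leq P b d"
          using an trans unfolding equ_def by blast+
        have "leq P (Imp d e) (Imp a m)" "leq P (Imp d e) (Imp b m)"
          using Imp_mono[OF thy abd(1)] Imp_mono[OF thy abd(2)] 2 by (simp_all add: equ_def)
        then have t: "leq P (Imp d e) m"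
          using le_m Imp_am Imp_bm trans unfolding equ_def by blast
        have "leq P m (Imp d e)"
          using 2 leq_Imp[OF thy] trans unfolding equ_def by blast
        then have "leq F u (k' (Imp d e))"
          using k_mono[OF mD tD _ t] k'm[OF t] by (simp add: u_def)
        moreover have "leq F (Imp (k' d) (k' e)) (And \<alpha> \<beta>)"
          using Imp_u[OF \<alpha>d] transF[OF Imp_u[OF \<beta>d] Imp_\<beta>u] abd
          by (simp add: leq_And_iff F \<beta>_def)
        ultimately show ?thesis
          using \<alpha>\<beta> transF by blast
      qed
    next
      case 3
      then have bd: "leq P b d"
        using cases[OF de(3)] d de(5) an trans unfolding equ_def by blast
      have "leq P (Imp d e) (Imp b a)"
        using Imp_mono[OF thy bd] 3 by (simp add: equ_def)
      then have "equ P (Imp d e) a"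
        using Imp_incomp[OF incomp_sym[OF ab(3)]] 3 leq_Imp[OF thy] trans unfolding equ_def by blast
      then show ?thesis
        using transF[OF antiF[OF \<beta>d[OF bd]] Imp_\<beta>\<alpha>] k'a 3 by simp
    next
      case 4
      then have ad: "leq P a d"
        using cases[OF de(3)] d de(5) an trans unfolding equ_def by blast
      have "leq P (Imp d e) (Imp a b)"
        using Imp_mono[OF thy ad] 4 by (simp add: equ_def)
      then have "equ P (Imp d e) b"
        using Imp_incomp[OF ab(3)] 4 leq_Imp[OF thy] trans unfolding equ_def by blast
      then show ?thesis
        using transF[OF antiF[OF \<alpha>d[OF ad]] Imp_\<alpha>\<beta>] k'b 4 by simp
    qed
  qed
  moreover have "equ P (k' d) d" if d: "d \<in> D" "leq P d n" for d
  proof -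
    have u: "equ P u m"
      using k(5)[OF mD] refl by (simp add: u_def m_def)
    have \<alpha>: "equ P \<alpha> a"
      using m_swap equ_trans[OF thy equ_Imp[OF thy equ_refl[OF thy] equ_trans[OF thy u]]
          Imp_And_incomp[OF incomp_sym[OF ab(3)]]]
      by (simp add: \<alpha>_def)
    then have \<beta>: "equ P \<beta> b"
      using equ_trans[OF thy equ_Imp[OF thy \<alpha> u]] Imp_And_incomp[OF ab(3)]
      by (simp add: \<beta>_def m_def)
    have "equ P (Or \<alpha> \<beta>) n"
      using equ_trans[OF thy equ_Or[OF thy \<alpha> \<beta>] equ_sym[OF n]] .
    consider "leq P d m" | "equ P d a" | "equ P d b" | "equ P d n"
      using cases[OF d(2)] by blast
    then show ?thesis
    proof cases
      case 1
      then show ?thesis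
        using k(5)[OF d(1)] k'm by (simp add: m_def)
    next
      case 2
      then show ?thesis
        using equ_trans[OF thy \<alpha> equ_sym] k'a by simp
    next
      case 3
      then show ?thesis
        using equ_trans[OF thy \<beta> equ_sym] k'b by simp
    next
      case 4
      then show ?thesis
        using equ_trans[OF thy \<open>equ P (Or \<alpha> \<beta>) n\<close> equ_sym] k'n by simp
    qed
  qed
  moreover have "leq F (k' Bot) Bot"
    using k(6) k'm[of Bot] by (simp add: thy)
  \<comment> \<open>In a prime quotient the top is not the join of an incomparable pair, so the
    clause for \<open>Top\<close> is void.\<close>
  moreover have "n \<noteq> Top"
  proof
    assume "n = Top"
    then have "Or a b \<in> P"
      using n Top_not_leq by (simp add: equ_def)
    then have "a \<in> P \<or> b \<in> P"
      by (rule prime_thyD(3)[OF prime])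
    then show False
      using not_le leq_of_mem[OF thy] by blast
  qed
  ultimately show ?thesis
    unfolding section_below_def by blast
qed


text \<open>Induction on the number of representatives strictly below \<open>n\<close>. A maximal
  one, \<open>a\<close>, is either above all of them, and then a node covered by \<open>n\<close>,
  or incomparable with some \<open>b\<close>; then \<open>n\<close> is the top of the diamond over
  \<open>And a b\<close>.\<close>

lemma section_exists:
  assumes "n \<in> D" "node n"
  shows "\<exists>k. section_below n k"
  using assms
proof (induction "card {r \<in> S. leq P r n \<and> \<not> leq P n r}" arbitrary: n rule: less_induct)
  case less
  note n = less.prems
  define A where "A n = {r \<in> S. leq P r n \<and> \<not> leq P n r}" for n
  have finite_A: "finite (A n)" for n
    using S(1) by (simp add: A_def)
  have A_rep: "\<exists>r\<in>A n. equ P d r" if "d \<in> D" "leq P d n" "\<not> leq P n d" for d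
    using S(3)[OF that(1)] that(2,3) trans unfolding A_def equ_def by blast
  show ?case
  proof (cases "A n = {}")
    case True
    then have "leq P n Bot"
      using A_rep[OF D_closed(1)] by (auto simp: thy)
    then show ?thesis
      using section_Bot by (auto simp: equ_def thy)
  next
    case False
    \<comment> \<open>\<open>leq\<close> is only a preorder on formulas, so maximality is taken for
      its strict part.\<close>
    define below where "below p q \<longleftrightarrow> leq P p q \<and> \<not> leq P q p" for p q
    have "asymp_on (A n) below" "transp_on (A n) below"
      using trans unfolding asymp_on_def transp_on_def below_def by blast+
    then obtain a where a: "a \<in> A n" and "\<forall>x\<in>A n. x \<noteq> a \<longrightarrow> \<not> below a x"
      using Finite_Set.bex_max_element[OF finite_A _ _ False] by blast
    then have max: "leq P x a" if "x \<in> A n" "leq P a x" for x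
      using that unfolding below_def by (cases "x = a") (auto simp: thy)
    have aD: "a \<in> D" "leq P a n" "\<not> leq P n a"
      using a S(2) by (auto simp: A_def)
    show ?thesis
    proof (cases "\<forall>b\<in>A n. leq P b a")
      case True
      have cover: "leq P d a" if "d \<in> D" "leq P d n" "\<not> leq P n d" for d
        using A_rep[OF that] True trans unfolding equ_def by blast
      have "node a"
        unfolding node_def
      proof (rule ccontr, clarsimp)
        fix d
        assume d: "\<not> leq P d a" "\<not> leq P a d"
        then have "d \<in> D"
          using twin[OF aD(1)] by (simp add: incomp_def)
        moreover have "leq P d n" "\<not> leq P n d"
          using d aD n(2) trans unfolding node_def by blast+
        ultimately show False
          using cover d by blast
      qed
      have "A a \<subset> A n"
        using a aD refl trans unfolding A_def by blast
      then have "card (A a) < card (A n)"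
        by (rule psubset_card_mono[OF finite_A])
      then obtain k where "section_below a k"
        using less.hyps[of a] aD(1) \<open>node a\<close> unfolding A_def by blast
      then show ?thesis
        using section_cover[OF n(2) \<open>node a\<close> aD cover] by blast
    next
      case False
      then obtain b where b: "b \<in> A n" "\<not> leq P b a"
        by blast
      have bD: "b \<in> D" "leq P b n"
        using b S(2) by (auto simp: A_def)
      have ab: "incomp P a b"
        using b max by (auto simp: incomp_def)
      have "leq P n (Or a b)"
      proof (rule ccontr)
        assume "\<not> ?thesis"
        moreover have "leq P (Or a b) n"
          using aD bD by (simp add: leq_Or_iff thy)
        ultimately obtain r where r: "r \<in> A n" "equ P (Or a b) r"
          using A_rep D_closed(4)[OF aD(1) bD(1)] by blast
        then have "leq P a r" "leq P b r"
          using leq_Or_left[OF thy] leq_Or_right[OF thy] trans unfolding equ_def by blast+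
        then show False
          using max[OF r(1)] b(2) trans by blast
      qed
      then have n_Or: "equ P n (Or a b)"
        using aD bD by (simp add: equ_def leq_Or_iff thy)
      have "leq P (And a b) a" "\<not> leq P a (And a b)"
        using ab by (auto simp: leq_And_left leq_And_iff incomp_def thy)
      then have "A (And a b) \<subset> A n"
        using a aD trans unfolding A_def by blast
      then have "card (A (And a b)) < card (A n)"
        by (rule psubset_card_mono[OF finite_A])
      then obtain k where "section_below (And a b) k"
        using less.hyps[of "And a b"] D_closed(3)[OF aD(1) bD(1)] node_And[OF ab] unfolding A_def by blast
      then show ?thesis
        using section_diamond[OF aD(1) bD(1) ab n_Or] by blast
    qed
  qed
qed

lemma retraction_exists:
  obtains k where "hom_on D F k" "\<And>d. d \<in> D \<Longrightarrow> equ P (k d) d"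
    "\<And>d. d \<in> D \<Longrightarrow> d \<in> P \<Longrightarrow> k d \<in> F"
proof -
  have "node Top"
    by (simp add: node_def thy)
  then obtain k where "section_below Top k"
    using section_exists D_closed(2) by blast
  note k = section_belowD[OF this]
  have "hom_on D F k"
    by (rule hom_onI[OF F(1) D]) (use k thy in auto)
  moreover have "k d \<in> F" if "d \<in> D" "d \<in> P" for d
    using k(1)[OF D_closed(2) that(1)] k(7) that(2) leq_mp[OF F(1)] leq_of_mem[OF thy] thy by simp
  ultimately show ?thesis
    using that[of k] k(5) thy by simp
qed

end

text \<open>Modulo \<open>F\<close> the section is a substitution. It takes members of
  \<open>P\<close> to members of \<open>F\<close>; conversely, its values are equivalent to their
  arguments modulo \<open>P\<close>, which contains \<open>F\<close>.\<close>

lemma (in prime_diamond) projective_substitution: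
  assumes F: "thy F" "F \<subseteq> P" and V: "finite V"
  obtains s where "\<And>q. vars q \<subseteq> V \<Longrightarrow> subst s q \<in> F \<longleftrightarrow> q \<in> P"
proof -
  obtain D S where D: "closed_fms D" "Var ` V \<subseteq> D" "\<And>d t. d \<in> D \<Longrightarrow> incomp P d t \<Longrightarrow> t \<in> D"
    and S: "finite S" "S \<subseteq> D" "\<And>d. d \<in> D \<Longrightarrow> \<exists>r\<in>S. equ P d r"
    by (rule finite_generation[OF finite_imageI[OF V, of Var]]) metis
  interpret ret: retraction_context P F D S
    by unfold_locales (fact F D S)+
  obtain k where k: "hom_on D F k" "\<And>d. d \<in> D \<Longrightarrow> equ P (k d) d"
    and retract: "\<And>d. d \<in> D \<Longrightarrow> d \<in> P \<Longrightarrow> k d \<in> F"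
    using ret.retraction_exists by blast
  define s where "s x = k (Var x)" for x
  have "subst s q \<in> F \<longleftrightarrow> q \<in> P" if q: "vars q \<subseteq> V" for q
  proof -
    have qD: "q \<in> D" and sq: "equ F (k q) (subst s q)"
      using hom_on_subst[OF F(1) D(1) k(1), of q s] q D(2) F(1) by (auto simp: s_def)
    have "subst s q \<in> F \<longleftrightarrow> k q \<in> F"
      using sq leq_mp[OF F(1)] unfolding equ_def by blast
    also have "k q \<in> F \<longleftrightarrow> q \<in> P"
    proof
      assume "k q \<in> F"
      then show "q \<in> P"
        using F(2) k(2)[OF qD] leq_mp[OF thy] unfolding equ_def by blast
    next
      assume "q \<in> P"
      then show "k q \<in> F"
        using retract qD by blast
    qed
    finally show ?thesis .
  qed
  then show ?thesis
    by (rule that)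
qed

section \<open>Hereditary structural completeness of diamond logics\<close>

lemma finite_vars [simp]: "finite (vars p)"
  by (induction p) simp_all

lemma prime_avoiding:
  assumes T: "thy T" and p: "p \<notin> T"
  obtains P where "prime_thy P" "T \<subseteq> P" "p \<notin> P"
proof -
  have "T \<inter> {q. leq T q p} = {}"
    using p leq_mp[OF T] by blast
  moreover have "{q. leq T q p} \<noteq> {}"
    using Bot_leq[OF T] by blast
  moreover have "Or q r \<in> {q. leq T q p}" if "q \<in> {q. leq T q p}" "r \<in> {q. leq T q p}" for q r
    using that by (simp add: leq_Or_iff T)
  ultimately obtain P where "prime_thy P" "T \<subseteq> P" "P \<inter> {q. leq T q p} = {}"
    using prime_extension[OF T, of "{q. leq T q p}"] by blast
  then show ?thesis
    using that leq_refl[OF T, of p] by blast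
qed

text \<open>If \<open>p\<close> does not follow from \<open>G\<close>, some prime theory
  \<open>P\<close> contains the consequences of \<open>G\<close> but not \<open>p\<close>. The
  substitution given by \<open>projective_substitution\<close> turns all of \<open>G\<close>, but
  not \<open>p\<close>, into theorems of \<open>C\<close>, so adding the rule creates a new
  theorem.\<close>

lemma hereditarily_structurally_complete_diamond_logic:
  assumes L: "diamond_logic L"
  shows "hereditarily_structurally_complete L"
  unfolding hereditarily_structurally_complete_def structurally_complete_def
proof (intro allI impI)
  fix C :: "nat fm set \<Rightarrow> nat fm \<Rightarrow> bool" and G p
  assume C: "consequence_relation C" and LC: "entails L \<le> C" and G: "finite G" and adm: "admissible C G p"
  have premise: "C G q" if "q \<in> G" for G q
    using C that by (simp add: consequence_relation_def)
  have cut: "C G q" if "\<And>r. r \<in> D \<Longrightarrow> C G r" "C D q" for G D q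
  proof -
    have "\<forall>G D q. (\<forall>r\<in>D. C G r) \<longrightarrow> C D q \<longrightarrow> C G q"
      using C unfolding consequence_relation_def by (elim conjE)
    then show ?thesis
      using that by (elim allE[of _ G] allE[of _ D] allE[of _ q] impE) auto
  qed
  have entails_C: "C G q" if "entails L G q" for G q
    using LC that by (auto simp: le_fun_def)
  have thy_C: "thy {q. C G q}" for G
  proof -
    have "C G r" if "C G (Imp q r)" "C G q" for q r
    proof (rule cut)
      show "C {Imp q r, q} r"
        by (intro entails_C) (meson entails.mp entails.premise insertI1 insertI2)
    qed (use that in auto)
    moreover have "C G q" if "q \<in> IPC" for q
      using L by (intro entails_C IPC_entails that) (simp add: diamond_logic_def)
    ultimately show ?thesis
      by (auto simp: thy_def)
  qed
  define F where "F = {q. C {} q}"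
  show "C G p"
  proof (rule ccontr)
    assume "\<not> C G p"
    then obtain P where P: "prime_thy P" "{q. C G q} \<subseteq> P" "p \<notin> P"
      using prime_avoiding[OF thy_C, of p G] by blast
    have FP: "F \<subseteq> P"
      using P(2) cut[of "{}"] by (auto simp: F_def)
    have "diamond_thy F"
      using diamond_thy_mono[OF diamond_thy_entails[OF L, of "{}"]] thy_C[of "{}"] entails_C
      by (auto simp: F_def)
    then interpret prime_diamond P
      using P(1) FP diamond_thy_mono prime_thyD(1) by unfold_locales blast+
    obtain s where s: "\<And>q. vars q \<subseteq> (\<Union>q\<in>insert p G. vars q) \<Longrightarrow> subst s q \<in> F \<longleftrightarrow> q \<in> P"
      using projective_substitution[of F "\<Union>q\<in>insert p G. vars q"] FP thy_C[of "{}"] G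
      by (auto simp: F_def)
    have sG: "C {} (subst s q)" if "q \<in> G" for q
      using s[of q] that P(2) premise[OF that] by (auto simp: F_def)
    have "add_rule C G p {} (subst s p)"
      unfolding add_rule_def
    proof (intro allI impI)
      fix C' :: "nat fm set \<Rightarrow> nat fm \<Rightarrow> bool"
      assume C': "consequence_relation C' \<and> C \<le> C' \<and> C' G p"
      have "C' (subst s ` G) (subst s p)"
        using C' by (simp add: consequence_relation_def)
      moreover have "C' {} q" if "q \<in> subst s ` G" for q
        using sG that C' by (auto simp: le_fun_def)
      moreover have "\<forall>G D q. (\<forall>r\<in>D. C' G r) \<longrightarrow> C' D q \<longrightarrow> C' G q"
        using C' unfolding consequence_relation_def by (elim conjE)
      ultimately show "C' {} (subst s p)"
        by blast
    qed
    then have "subst s p \<in> F"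
      using adm by (auto simp: admissible_def F_def)
    then have "p \<in> P"
      using s[of p] by auto
    with P(3) show False
      by simp
  qed
qed

section \<open>Concrete Heyting algebras\<close>

text \<open>The lattice operations and \<open>himp\<close> are picked from the order by description;
  here they are identified with explicit operations that have the same universal properties.\<close>

locale heyting_operations = partial_order A for A :: "'a gorder" (structure) +
  fixes glb lub imp :: "'a \<Rightarrow> 'a \<Rightarrow> 'a" and bot top :: 'a
  assumes closed: "bot \<in> carrier A" "top \<in> carrier A"
      "\<lbrakk>x \<in> carrier A; y \<in> carrier A\<rbrakk> \<Longrightarrow> glb x y \<in> carrier A"
      "\<lbrakk>x \<in> carrier A; y \<in> carrier A\<rbrakk> \<Longrightarrow> lub x y \<in> carrier A"
      "\<lbrakk>x \<in> carrier A; y \<in> carrier A\<rbrakk> \<Longrightarrow> imp x y \<in> carrier A"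
    and bot: "x \<in> carrier A \<Longrightarrow> bot \<sqsubseteq> x" and top: "x \<in> carrier A \<Longrightarrow> x \<sqsubseteq> top"
    and glb: "\<lbrakk>x \<in> carrier A; y \<in> carrier A; z \<in> carrier A\<rbrakk> \<Longrightarrow> z \<sqsubseteq> glb x y \<longleftrightarrow> z \<sqsubseteq> x \<and> z \<sqsubseteq> y"
    and lub: "\<lbrakk>x \<in> carrier A; y \<in> carrier A; z \<in> carrier A\<rbrakk> \<Longrightarrow> lub x y \<sqsubseteq> z \<longleftrightarrow> x \<sqsubseteq> z \<and> y \<sqsubseteq> z"
    and imp: "\<lbrakk>x \<in> carrier A; y \<in> carrier A; z \<in> carrier A\<rbrakk> \<Longrightarrow> z \<sqsubseteq> imp x y \<longleftrightarrow> glb z x \<sqsubseteq> y"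
begin

lemma greatest_glb:
  assumes "x \<in> carrier A" "y \<in> carrier A"
  shows "greatest A (glb x y) (Lower A {x, y})"
  using assms closed(3) glb[OF assms] glb[OF assms closed(3)[OF assms]]
  by (auto simp: greatest_def Lower_def)

lemma least_lub:
  assumes "x \<in> carrier A" "y \<in> carrier A"
  shows "least A (lub x y) (Upper A {x, y})"
  using assms closed(4) lub[OF assms] lub[OF assms closed(4)[OF assms]]
  by (auto simp: least_def Upper_def)

lemma meet_eq: "\<lbrakk>x \<in> carrier A; y \<in> carrier A\<rbrakk> \<Longrightarrow> x \<sqinter> y = glb x y"
  unfolding meet_def inf_def by (rule some_equality) (auto intro: greatest_glb greatest_unique)

lemma join_eq: "\<lbrakk>x \<in> carrier A; y \<in> carrier A\<rbrakk> \<Longrightarrow> x \<squnion> y = lub x y"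
  unfolding join_def sup_def by (rule some_equality) (auto intro: least_lub least_unique)

lemma greatest_imp:
  assumes "x \<in> carrier A" "y \<in> carrier A"
  shows "greatest A (imp x y) {z \<in> carrier A. z \<sqinter> x \<sqsubseteq> y}"
  using assms closed(5) imp[OF assms] imp[OF assms closed(5)[OF assms]]
  by (auto simp: greatest_def meet_eq)

lemma himp_eq: "\<lbrakk>x \<in> carrier A; y \<in> carrier A\<rbrakk> \<Longrightarrow> himp A x y = imp x y"
  unfolding himp_def by (rule the_equality) (auto intro: greatest_imp greatest_unique)

lemma greatest_top: "greatest A top (carrier A)"
  using closed(2) top by (simp add: greatest_def)

lemma least_bot: "least A bot (carrier A)"
  using closed(1) bot by (simp add: least_def)

lemma top_eq: "\<top> = top"
  unfolding top_def by (rule some_equality) (auto intro: greatest_top greatest_unique)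

lemma bottom_eq: "\<bottom> = bot"
  unfolding bottom_def by (rule some_equality) (auto intro: least_bot least_unique)

lemma heyting: "heyting_algebra A"
  by unfold_locales (blast intro: greatest_glb least_lub greatest_top least_bot greatest_imp)+

end


section \<open>Finite diamond sequences validate the axioms\<close>

text \<open>The Kripke clause for implication: the residual of intersection on upsets.\<close>

definition up_imp :: "'a gorder \<Rightarrow> 'a set \<Rightarrow> 'a set \<Rightarrow> 'a set" where
  "up_imp X U W = {x \<in> carrier X. \<forall>y\<in>carrier X. x \<sqsubseteq>\<^bsub>X\<^esub> y \<longrightarrow> y \<in> U \<longrightarrow> y \<in> W}"

lemma Up_operations:
  assumes "partial_order X"
  shows "heyting_operations (Up X) (\<inter>) (\<union>) (up_imp X) {} (carrier X)"
proof -
  interpret partial_order X by (rule assms)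
  have trans: "x \<sqsubseteq>\<^bsub>X\<^esub> y \<Longrightarrow> y \<sqsubseteq>\<^bsub>X\<^esub> z \<Longrightarrow> x \<in> carrier X \<Longrightarrow> y \<in> carrier X \<Longrightarrow> z \<in> carrier X \<Longrightarrow> x \<sqsubseteq>\<^bsub>X\<^esub> z" for x y z
    by (rule le_trans)
  show ?thesis
    by unfold_locales (auto simp: Up_def up_imp_def intro: trans)
qed

locale finite_diamond_sequence = diamond_sequence X for X :: "'a gorder" (structure) +
  assumes finite_carrier: "finite (carrier X)"
begin

sublocale up: heyting_operations "Up X" "(\<inter>)" "(\<union>)" "up_imp X" "{}" "carrier X"
  by (rule Up_operations) unfold_locales

lemma lower_bound:
  assumes "carrier X \<noteq> {}"
  shows "\<exists>r\<in>carrier X. \<forall>x\<in>carrier X. r \<sqsubseteq> x"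
proof -
  have "\<exists>r\<in>carrier X. \<forall>x\<in>B. r \<sqsubseteq> x" if "finite B" "B \<subseteq> carrier X" for B
    using that
  proof (induction B rule: finite_induct)
    case empty
    then show ?case
      using assms by blast
  next
    case (insert b B)
    then obtain r where r: "r \<in> carrier X" "\<forall>x\<in>B. r \<sqsubseteq> x"
      by blast
    then obtain w where w: "w \<in> carrier X" "w \<sqsubseteq> r" "w \<sqsubseteq> b"
      using common_lower_bound[of r b] insert.prems by blast
    have "w \<sqsubseteq> x" if "x \<in> insert b B" for x
      using le_trans[of w r x] r w insert.prems that by auto
    then show ?case
      using w(1) by blast
  qed
  then show ?thesis
    using finite_carrier by blast
qed

lemma principal_root:
  assumes "r \<in> carrier X" "\<And>x. x \<in> carrier X \<Longrightarrow> r \<sqsubseteq> x"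
  shows "principal_upset X r = X"
proof -
  have "{y \<in> carrier X. r \<sqsubseteq> y} = carrier X"
    using assms by blast
  then show ?thesis
    by (simp add: principal_upset_def)
qed

definition inc :: "'a \<Rightarrow> 'a \<Rightarrow> bool" where
  "inc x y \<longleftrightarrow> x \<in> carrier X \<and> y \<in> carrier X \<and> \<not> x \<sqsubseteq> y \<and> \<not> y \<sqsubseteq> x"

lemma inc_sym: "inc x y \<Longrightarrow> inc y x"
  by (auto simp: inc_def)

text \<open>A finite nonempty diamond sequence has a root, whose principal upset is the whole poset,
  so the local conditions \<open>D1\<close> and \<open>D2\<close> become global.\<close>

lemma carrier_props:
  assumes "x \<in> carrier X"
  shows "three_point_rule X" "\<not> (\<exists>B. antichain X B \<and> card B = 3)"
proof -
  have "carrier X \<noteq> {}"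
    using assms by auto
  then obtain r where r: "r \<in> carrier X" "\<And>x. x \<in> carrier X \<Longrightarrow> r \<sqsubseteq> x"
    using lower_bound by blast
  then show "three_point_rule X" "\<not> (\<exists>B. antichain X B \<and> card B = 3)"
    using D1[OF r(1)] D2[OF r(1)] principal_root[OF r] by simp_all
qed

text \<open>Without three-element antichains \<open>z\<close> is comparable with \<open>x\<close> or
  \<open>y\<close>, and the three point rule transfers the comparison to the other one. Downwards:
  if \<open>z\<close> were below \<open>x\<close> but incomparable with \<open>y\<close>, the rule
  would put \<open>y\<close> below \<open>x\<close>.\<close>

lemma above_or_below:
  assumes xy: "inc x y" and z: "z \<in> carrier X" "z \<noteq> x" "z \<noteq> y"
  shows "x \<sqsubseteq> z \<and> y \<sqsubseteq> z \<or> z \<sqsubseteq> x \<and> z \<sqsubseteq> y"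
proof -
  have car: "x \<in> carrier X" "y \<in> carrier X" and "x \<noteq> y"
    using xy le_refl unfolding inc_def by blast+
  have three: "q \<sqsubseteq> r" if "inc p q" "r \<in> carrier X" "p \<sqsubseteq> r" "p \<noteq> r" for p q r
  proof (cases "q = r")
    case False
    moreover have "p \<noteq> q"
      using that(1) by (auto simp: inc_def)
    ultimately show ?thesis
      using carrier_props(1)[OF z(1)] that unfolding three_point_rule_def inc_def by blast
  qed (use that in \<open>auto simp: inc_def\<close>)
  have "\<not> (inc x z \<and> inc y z)"
  proof
    assume "inc x z \<and> inc y z"
    then have "antichain X {x, y, z}"
      using xy by (auto simp: antichain_def inc_def)
    moreover have "card {x, y, z} = 3"
      using z \<open>x \<noteq> y\<close> by auto
    ultimately show False
      using carrier_props(2)[OF z(1)] by blast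
  qed
  then consider "x \<sqsubseteq> z" | "y \<sqsubseteq> z" | "z \<sqsubseteq> x" | "z \<sqsubseteq> y"
    using car z(1) by (auto simp: inc_def)
  then show ?thesis
  proof cases
    case 1
    then show ?thesis
      using three[OF xy z(1)] z by blast
  next
    case 2
    then show ?thesis
      using three[OF inc_sym[OF xy] z(1)] z by blast
  next
    case 3
    have "\<not> y \<sqsubseteq> z"
      using 3 xy z(1) le_trans unfolding inc_def by blast
    moreover have "\<not> inc z y"
      using three[of z y x] 3 z car xy by (auto simp: inc_def)
    ultimately show ?thesis
      using 3 car z(1) by (auto simp: inc_def)
  next
    case 4
    have "\<not> x \<sqsubseteq> z"
      using 4 xy z(1) le_trans unfolding inc_def by blast
    moreover have "\<not> inc z x"
      using three[of z x y] 4 z car xy by (auto simp: inc_def)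
    ultimately show ?thesis
      using 4 car z(1) by (auto simp: inc_def)
  qed
qed

lemma inc_unique:
  assumes "inc x y" "inc x z"
  shows "y = z"
  using above_or_below[OF assms(1), of z] assms(2) by (auto simp: inc_def)

section \<open>Incomparable upsets\<close>

lemma up_closed: "U \<in> carrier (Up X) \<Longrightarrow> x \<in> U \<Longrightarrow> y \<in> carrier X \<Longrightarrow> x \<sqsubseteq> y \<Longrightarrow> y \<in> U"
  and up_subset: "U \<in> carrier (Up X) \<Longrightarrow> x \<in> U \<Longrightarrow> x \<in> carrier X"
  by (auto simp: Up_def)

lemma inc_of_diff:
  assumes "U \<in> carrier (Up X)" "W \<in> carrier (Up X)" "x \<in> U" "x \<notin> W" "y \<in> W" "y \<notin> U"
  shows "inc x y"
  using assms up_closed up_subset unfolding inc_def by blast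

text \<open>Incomparable upsets are told apart by a pair of incomparable points, and the pairs for
  \<open>U\<close>, \<open>W\<close> and for \<open>U\<close>, \<open>Z\<close> turn out to be the
  same. A point of \<open>W\<close> outside \<open>Z\<close> could then be neither above nor below
  both points of this pair.\<close>

lemma upset_twin_subset:
  assumes up: "U \<in> carrier (Up X)" "W \<in> carrier (Up X)" "Z \<in> carrier (Up X)"
    and UW: "\<not> U \<subseteq> W" "\<not> W \<subseteq> U" and UZ: "\<not> U \<subseteq> Z" "\<not> Z \<subseteq> U"
  shows "W \<subseteq> Z"
proof -
  obtain u w where uw: "u \<in> U" "u \<notin> W" "w \<in> W" "w \<notin> U"
    using UW by blast
  obtain u' z where uz: "u' \<in> U" "u' \<notin> Z" "z \<in> Z" "z \<notin> U"
    using UZ by blast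
  have inc: "inc u w" "inc u' z"
    using inc_of_diff up uw uz by blast+
  have car: "u \<in> carrier X" "w \<in> carrier X" "u' \<in> carrier X" "z \<in> carrier X"
    using inc by (auto simp: inc_def)
  have "z = w"
  proof (rule ccontr)
    assume "z \<noteq> w"
    moreover have "z \<noteq> u" "u' \<noteq> w"
      using uw uz by blast+
    moreover have "\<not> u \<sqsubseteq> z" "\<not> u' \<sqsubseteq> w"
      using up_closed[OF up(1)] uw uz car by blast+
    ultimately have "z \<sqsubseteq> u" "z \<sqsubseteq> w"
      using above_or_below[OF inc(1) car(4)] by blast+
    then have "u \<in> Z"
      using up_closed[OF up(3)] uz car by blast
    then have "u' \<noteq> u"
      using uz by blast
    then have "u \<sqsubseteq> u'"
      using above_or_below[OF inc(1) car(3)] \<open>u' \<noteq> w\<close> \<open>\<not> u' \<sqsubseteq> w\<close> by blast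
    then show False
      using up_closed[OF up(3) \<open>u \<in> Z\<close>] car uz by blast
  qed
  then have "u' = u"
    using inc inc_unique inc_sym by blast
  show ?thesis
  proof
    fix t
    assume t: "t \<in> W"
    show "t \<in> Z"
    proof (rule ccontr)
      assume "t \<notin> Z"
      moreover have tX: "t \<in> carrier X"
        using up_subset up(2) t by blast
      ultimately have "t \<noteq> w" "t \<noteq> u" "\<not> w \<sqsubseteq> t" "\<not> t \<sqsubseteq> u"
        using \<open>z = w\<close> uz uw t up_closed[OF up(3)] up_closed[OF up(2)] car by blast+
      then show False
        using above_or_below[OF inc(1) tX] by blast
    qed
  qed
qed

lemma up_impI: "U \<subseteq> W \<Longrightarrow> up_imp X U W = carrier X"
  by (auto simp: up_imp_def)

lemma up_carrier_max: "U \<in> carrier (Up X) \<Longrightarrow> U \<subseteq> carrier X"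
  by (auto simp: Up_def)

text \<open>Points outside \<open>c \<union> d\<close> lie below both \<open>z\<close> and
  \<open>v\<close>, in particular \<open>p\<close> and \<open>q\<close>. With bounds from
  \<open>D3\<close> and the common lower bound, \<open>D4\<close> interpolates a point
  \<open>w\<close> of \<open>a \<inter> b\<close> outside \<open>c \<union> d\<close>. A point
  \<open>x\<close> violating the claim would be incomparable with \<open>w\<close>, hence above
  \<open>p\<close> and \<open>q\<close> and so in \<open>a \<inter> b\<close>, which is
  impossible.\<close>

lemma up_separated:
  assumes up: "a \<in> carrier (Up X)" "b \<in> carrier (Up X)" "c \<in> carrier (Up X)" "d \<in> carrier (Up X)"
    and sub: "c \<union> d \<subseteq> a" "c \<union> d \<subseteq> b" and ab: "\<not> a \<subseteq> b" "\<not> b \<subseteq> a" and cd: "\<not> c \<subseteq> d" "\<not> d \<subseteq> c"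
  shows "up_imp X (a \<inter> b) (c \<union> d) \<subseteq> c \<union> d"
proof -
  obtain p q where pq: "p \<in> a" "p \<notin> b" "q \<in> b" "q \<notin> a"
    using ab by blast
  obtain z v where zv: "z \<in> c" "z \<notin> d" "v \<in> d" "v \<notin> c"
    using cd by blast
  have inc: "inc p q" "inc z v"
    using inc_of_diff up pq zv by blast+
  have car: "p \<in> carrier X" "q \<in> carrier X" "z \<in> carrier X" "v \<in> carrier X"
    using inc by (auto simp: inc_def)
  have below: "x \<sqsubseteq> z \<and> x \<sqsubseteq> v" if "x \<in> carrier X" "x \<notin> c \<union> d" for x
    using above_or_below[OF inc(2) that(1)] that zv up_closed[OF up(3) zv(1)] by blast
  have pq_below: "p \<sqsubseteq> z" "p \<sqsubseteq> v" "q \<sqsubseteq> z" "q \<sqsubseteq> v"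
    using below[OF car(1)] below[OF car(2)] pq sub by blast+
  obtain t where t: "t \<in> carrier X" "z \<sqsubseteq> t" "v \<sqsubseteq> t"
    using D3[of p z v] car pq_below by blast
  obtain r where r: "r \<in> carrier X" "r \<sqsubseteq> p" "r \<sqsubseteq> q"
    using common_lower_bound[OF car(1,2)] by blast
  obtain w where w: "w \<in> carrier X" "p \<sqsubseteq> w" "q \<sqsubseteq> w" "w \<sqsubseteq> z" "w \<sqsubseteq> v"
    using D4[OF r(1) car t(1) r(2,3) pq_below t(2,3)] by blast
  have w_in: "w \<in> a \<inter> b"
    using up_closed up pq w by blast
  have w_out: "w \<notin> c \<union> d"
    using up_closed[OF up(3), of w v] up_closed[OF up(4), of w z] w zv car by blast
  show ?thesis
  proof
    fix x
    assume x: "x \<in> up_imp X (a \<inter> b) (c \<union> d)"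
    show "x \<in> c \<union> d"
    proof (rule ccontr)
      assume x_out: "x \<notin> c \<union> d"
      have xX: "x \<in> carrier X" and x_imp: "\<And>y. y \<in> carrier X \<Longrightarrow> x \<sqsubseteq> y \<Longrightarrow> y \<in> a \<inter> b \<Longrightarrow> y \<in> c \<union> d"
        using x by (auto simp: up_imp_def)
      have x_ab: "x \<notin> a \<inter> b"
        using x_imp[of x] xX x_out by blast
      moreover have "\<not> x \<sqsubseteq> w"
        using x_imp[of w] w w_in w_out by blast
      moreover have "\<not> w \<sqsubseteq> x"
        using up_closed[OF up(1), of w x] up_closed[OF up(2), of w x] w_in x_ab xX by blast
      ultimately have xw: "inc x w"
        using xX w by (simp add: inc_def)
      \<comment> \<open>By \<open>above_or_below\<close>, whatever is strictly below
        \<open>w\<close> is also below its incomparable partner \<open>x\<close>.\<close>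
      have "y \<sqsubseteq> x" if "y \<in> carrier X" "y \<sqsubseteq> w" "\<not> w \<sqsubseteq> y" for y
        using above_or_below[OF xw that(1)] that xw w(1) le_refl unfolding inc_def by blast
      moreover have "\<not> w \<sqsubseteq> p" "\<not> w \<sqsubseteq> q"
        using inc(1) w car le_trans unfolding inc_def by blast+
      ultimately have "p \<sqsubseteq> x" "q \<sqsubseteq> x"
        using car w by blast+
      then show False
        using up_closed[OF up(1) pq(1) xX] up_closed[OF up(2) pq(3) xX] x_ab by blast
    qed
  qed
qed

lemma satisfies_axioms:
  "satisfies_eq (Up X) (unique_incomp_fm (Var 0) (Var 1) (Var 2), Top :: nat fm)"
  "satisfies_eq (Up X) (separated_fm (Var 0) (Var 1) (Var 2) (Var 3), Top :: nat fm)"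
proof -
  note ops = up.meet_eq up.join_eq up.himp_eq up.top_eq up.closed
  have max: "carrier X \<union> U = carrier X" "U \<union> carrier X = carrier X" if "U \<in> carrier (Up X)" for U
    using up_carrier_max[OF that] by blast+
  show "satisfies_eq (Up X) (unique_incomp_fm (Var 0) (Var 1) (Var 2), Top :: nat fm)"
    unfolding satisfies_eq_def fst_conv snd_conv
  proof (intro allI impI)
    fix h :: "nat \<Rightarrow> 'a set"
    assume "range h \<subseteq> carrier (Up X)"
    then have h: "h v \<in> carrier (Up X)" for v
      by blast
    let ?u = "h 0" and ?w = "h 1" and ?z = "h 2"
    have "?u \<subseteq> ?w \<or> ?w \<subseteq> ?u \<or> ?u \<subseteq> ?z \<or> ?z \<subseteq> ?u \<or> ?w = ?z"
      using upset_twin_subset[OF h h h, of 0 1 2] upset_twin_subset[OF h h h, of 0 2 1] by blast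
    then show "eval (Up X) h (unique_incomp_fm (Var 0) (Var 1) (Var 2)) = eval (Up X) h Top"
      by (elim disjE) (simp_all add: unique_incomp_fm_def ops h up_impI max)
  qed
  show "satisfies_eq (Up X) (separated_fm (Var 0) (Var 1) (Var 2) (Var 3), Top :: nat fm)"
    unfolding satisfies_eq_def fst_conv snd_conv
  proof (intro allI impI)
    fix h :: "nat \<Rightarrow> 'a set"
    assume "range h \<subseteq> carrier (Up X)"
    then have h: "h v \<in> carrier (Up X)" for v
      by blast
    define w where "w = h 2 \<union> h 3"
    define a where "a = h 0 \<union> w"
    define b where "b = h (Suc 0) \<union> w"
    have wab: "w \<in> carrier (Up X)" "a \<in> carrier (Up X)" "b \<in> carrier (Up X)"
      by (simp_all add: w_def a_def b_def up.closed h)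
    have "a \<subseteq> b \<or> b \<subseteq> a \<or> h 2 \<subseteq> h 3 \<or> h 3 \<subseteq> h 2 \<or> up_imp X (a \<inter> b) w \<subseteq> w"
      using up_separated[OF wab(2,3) h h, of 2 3] by (auto simp: a_def b_def w_def)
    moreover have "eval (Up X) h (separated_fm (Var 0) (Var 1) (Var 2) (Var 3)) =
      up_imp X a b \<union> (up_imp X b a \<union> (up_imp X (h 2) (h 3) \<union> (up_imp X (h 3) (h 2) \<union>
        up_imp X (up_imp X (a \<inter> b) w) w)))"
      using h wab by (simp add: separated_fm_def Let_def ops flip: w_def a_def b_def)
    ultimately show "eval (Up X) h (separated_fm (Var 0) (Var 1) (Var 2) (Var 3)) = eval (Up X) h Top"
      using h wab by (elim disjE) (simp_all add: ops up_impI max)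
  qed
qed

end


section \<open>Lindenbaum algebras\<close>

definition fm_class :: "'v fm set \<Rightarrow> 'v fm \<Rightarrow> 'v fm set" where
  "fm_class T p = {q. equ T p q}"

definition representative :: "'v fm set \<Rightarrow> 'v fm" where
  "representative A = (SOME p. p \<in> A)"

text \<open>The order compares chosen representatives; by \<open>le_lindenbaum\<close> the choice is
  immaterial. For formulas over \<open>nat\<close> the algebra lives on the type at which the
  inclusion in \<open>DHA\<close> is assumed.\<close>

definition lindenbaum :: "'v fm set \<Rightarrow> 'v fm set gorder" where
  "lindenbaum T = \<lparr>carrier = range (fm_class T), eq = (=),
     le = (\<lambda>A B. leq T (representative A) (representative B))\<rparr>"

context
  fixes T :: "'v fm set"
  assumes T: "thy T"
begin

lemma fm_class_eq: "fm_class T p = fm_class T q \<longleftrightarrow> equ T p q"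
proof
  assume "fm_class T p = fm_class T q"
  then have "q \<in> fm_class T p"
    by (simp add: fm_class_def T)
  then show "equ T p q"
    by (simp add: fm_class_def)
next
  assume "equ T p q"
  then show "fm_class T p = fm_class T q"
    using equ_trans[OF T] equ_sym unfolding fm_class_def by blast
qed

lemma representative_equ: "equ T p (representative (fm_class T p))"
proof -
  have "p \<in> fm_class T p"
    by (simp add: fm_class_def T)
  then have "representative (fm_class T p) \<in> fm_class T p"
    unfolding representative_def by (rule someI)
  then show ?thesis
    by (simp add: fm_class_def)
qed

lemma le_lindenbaum: "fm_class T p \<sqsubseteq>\<^bsub>lindenbaum T\<^esub> fm_class T q \<longleftrightarrow> leq T p q"
proof -
  have "leq T (representative (fm_class T p)) (representative (fm_class T q)) \<longleftrightarrow> leq T p q"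
    using representative_equ[of p] representative_equ[of q] leq_trans[OF T]
    unfolding equ_def by blast
  then show ?thesis
    by (simp add: lindenbaum_def)
qed

definition lift2 :: "('v fm \<Rightarrow> 'v fm \<Rightarrow> 'v fm) \<Rightarrow> 'v fm set \<Rightarrow> 'v fm set \<Rightarrow> 'v fm set" where
  "lift2 f A B = fm_class T (f (representative A) (representative B))"

lemma lift2_class:
  "lift2 And (fm_class T p) (fm_class T q) = fm_class T (And p q)"
  "lift2 Or (fm_class T p) (fm_class T q) = fm_class T (Or p q)"
  "lift2 Imp (fm_class T p) (fm_class T q) = fm_class T (Imp p q)"
  using representative_equ[of p] representative_equ[of q]
  by (auto simp: lift2_def fm_class_eq intro: equ_sym equ_And[OF T] equ_Or[OF T] equ_Imp[OF T])

lemma lindenbaum_operations: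
  "heyting_operations (lindenbaum T) (lift2 And) (lift2 Or) (lift2 Imp) (fm_class T Bot) (fm_class T Top)"
proof -
  have carrier: "carrier (lindenbaum T) = range (fm_class T)" and eq: "(.=\<^bsub>lindenbaum T\<^esub>) = (=)"
    by (simp_all add: lindenbaum_def)
  show ?thesis
  proof (unfold_locales, unfold carrier eq)
    fix x y z
    show "x \<in> range (fm_class T) \<Longrightarrow> y \<in> range (fm_class T) \<Longrightarrow> z \<in> range (fm_class T) \<Longrightarrow>
      x \<sqsubseteq>\<^bsub>lindenbaum T\<^esub> y \<Longrightarrow> y \<sqsubseteq>\<^bsub>lindenbaum T\<^esub> z \<Longrightarrow> x \<sqsubseteq>\<^bsub>lindenbaum T\<^esub> z"
      using leq_trans[OF T] by (auto simp: le_lindenbaum)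
    show "x \<sqsubseteq>\<^bsub>lindenbaum T\<^esub> y \<Longrightarrow> y \<sqsubseteq>\<^bsub>lindenbaum T\<^esub> x \<Longrightarrow>
      x \<in> range (fm_class T) \<Longrightarrow> y \<in> range (fm_class T) \<Longrightarrow> x = y"
      by (elim imageE) (simp add: le_lindenbaum fm_class_eq equ_def)
  qed (auto simp: le_lindenbaum lift2_class T leq_And_iff leq_Or_iff leq_Imp_iff)
qed

interpretation heyting_operations "lindenbaum T" "lift2 And" "lift2 Or" "lift2 Imp" "fm_class T Bot" "fm_class T Top"
  by (rule lindenbaum_operations)

lemma eval_lindenbaum:
  "(\<And>v. h v = fm_class T (s v)) \<Longrightarrow> eval (lindenbaum T) h p = fm_class T (subst s p)"
proof (induction p)
  have "fm_class T p \<in> carrier (lindenbaum T)" for p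
    by (simp add: lindenbaum_def)
  note this [simp] meet_eq [simp] join_eq [simp] himp_eq [simp] lift2_class [simp]
  {
    case (And p q) then show ?case by simp
  next
    case (Or p q) then show ?case by simp
  next
    case (Imp p q) then show ?case by simp
  }
qed (simp_all add: top_eq bottom_eq)

lemma heyting_lindenbaum: "heyting_algebra (lindenbaum T)"
  by (rule heyting)

text \<open>Valuations in the Lindenbaum algebra are substitutions modulo \<open>T\<close>.\<close>

lemma satisfies_lindenbaum:
  fixes p :: "'u fm"
  shows "satisfies_eq (lindenbaum T) (p, Top) \<longleftrightarrow> (\<forall>s. subst s p \<in> T)"
proof
  assume sat: "satisfies_eq (lindenbaum T) (p, Top)"
  show "\<forall>s. subst s p \<in> T"
  proof
    fix s :: "'u \<Rightarrow> 'v fm"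
    have "range (\<lambda>v. fm_class T (s v)) \<subseteq> carrier (lindenbaum T)"
      by (auto simp: lindenbaum_def)
    with sat have "eval (lindenbaum T) (\<lambda>v. fm_class T (s v)) p =
        eval (lindenbaum T) (\<lambda>v. fm_class T (s v)) Top"
      unfolding satisfies_eq_def fst_conv snd_conv by blast
    then have "equ T (subst s p) Top"
      by (simp add: eval_lindenbaum[of _ s] fm_class_eq top_eq)
    then show "subst s p \<in> T"
      using mem_iff_leq[OF T] by (simp add: equ_def)
  qed
next
  assume T': "\<forall>s. subst s p \<in> T"
  show "satisfies_eq (lindenbaum T) (p, Top)"
    unfolding satisfies_eq_def
  proof (intro allI impI)
    fix h :: "'u \<Rightarrow> 'v fm set"
    assume "range h \<subseteq> carrier (lindenbaum T)"
    then have "\<forall>v. \<exists>q. h v = fm_class T q"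
      by (auto simp: lindenbaum_def)
    then obtain s where s: "\<And>v. h v = fm_class T (s v)"
      by metis
    have "equ T (subst s p) Top"
      using T' by (simp add: equ_def T leq_of_mem)
    then show "eval (lindenbaum T) h (fst (p, Top)) = eval (lindenbaum T) h (snd (p, Top))"
      by (simp add: eval_lindenbaum[OF s] fm_class_eq top_eq)
  qed
qed

end

text \<open>The Lindenbaum algebra of \<open>L\<close> validates \<open>L\<close> because
  \<open>L\<close> is closed under substitution, so it belongs to \<open>DHA\<close> and satisfies
  the two equations valid in all generators. The identity substitution turns these into members of
  \<open>L\<close>.\<close>

lemma diamond_logic_of_variety:
  assumes L: "intermediate_logic L"
    and sub: "(variety_of_logic L :: nat fm set gorder set) \<subseteq> DHA"
  shows "diamond_logic L"
proof -
  have thy: "thy L"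
    using L by (auto simp: thy_def intermediate_logic_def)
  have subst: "subst s p \<in> L" if "p \<in> L" for s p
    using L that by (auto simp: intermediate_logic_def)
  let ?E = "{(unique_incomp_fm (Var 0) (Var 1) (Var 2), Top :: nat fm),
    (separated_fm (Var 0) (Var 1) (Var 2) (Var 3), Top)}"
  have "lindenbaum L \<in> variety_of_logic L"
    using heyting_lindenbaum[OF thy]
    by (auto simp: variety_of_logic_def variety_of_equations_def satisfies_lindenbaum[OF thy] subst)
  then have "lindenbaum L \<in> DHA"
    using sub by blast
  moreover have "Up X \<in> variety_of_equations ?E"
    if "finite (carrier X)" "diamond_sequence X" for X :: "nat gorder"
  proof -
    interpret diamond_sequence X
      by (rule that)
    interpret finite_diamond_sequence X
      by unfold_locales (rule that)
    show ?thesis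
      using satisfies_axioms up.heyting by (simp add: variety_of_equations_def)
  qed
  then have "{Up X | X :: nat gorder. finite (carrier X) \<and> diamond_sequence X} \<subseteq> variety_of_equations ?E"
    by blast
  ultimately have "lindenbaum L \<in> variety_of_equations ?E"
    unfolding DHA_def generated_variety_def by blast
  then have sat: "satisfies_eq (lindenbaum L) e" if "e \<in> ?E" for e
    using that by (simp only: variety_of_equations_def mem_Collect_eq)
  have "subst Var (unique_incomp_fm (Var 0) (Var 1) (Var 2) :: nat fm) \<in> L"
    "subst Var (separated_fm (Var 0) (Var 1) (Var 2) (Var 3) :: nat fm) \<in> L"
    using sat[THEN satisfies_lindenbaum[OF thy, THEN iffD1, THEN spec]] by blast+
  then show ?thesis
    using L by (simp add: diamond_logic_def)
qed

theorem theorem7p4: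
  fixes L :: "nat fm set"
  assumes "intermediate_logic L"
    and "(variety_of_logic L :: nat fm set gorder set) \<subseteq> DHA"
  shows "hereditarily_structurally_complete L \<and> infinite_beth_property TYPE('v) L"
  using diamond_logic_of_variety[OF assms] hereditarily_structurally_complete_diamond_logic
    infinite_beth_diamond_logic by blast

end
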